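(* Let $X$ be a separable Banach space and let $Y$ be a Banach space with the Radon-Nikodým property. Given a mapping $f:X\to Y$, let $S(f)$ be the set of all points $x\in X$ at which $f$ is pointwise Lipschitz. Then there exists a set $E\in\tilde{\mathcal{A}}$ such that $f$ is Gâteaux differentiable at every point of $S(f)\setminus E$.
   Context: All Banach spaces are real. A mapping $f:X\to Y$ is pointwise Lipschitz at $x\in X$ if $\limsup_{y\to x}\frac{\|f(x)-f(y)\|}{\|x-y\|}<\infty$. For $x,v\in X$ put $f'(x,v)=\lim_{t\to 0}\frac{f(x+tv)-f(x)}{t}$ (two-sided limit). $f$ is Gâteaux differentiable at $x$ if $f'(x,v)$ exists for all $v\in X$ and $v\mapsto f'(x,v)$ is a bounded linear operator from $X$ to $Y$. Let $X$ be a separable Banach space, $0\neq v\in X$ and $\varepsilon>0$. $\tilde{\mathcal{A}}(v,\varepsilon)$ is the system of all Borel sets $B\subset X$ such that $\{t\in\mathbb{R}:\varphi(t)\in B\}$ is Lebesgue null whenever $\varphi:\mathbb{R}\to X$ is such that the function $t\mapsto\varphi(t)-tv$ has Lipschitz constant at most $\varepsilon$. $\tilde{\mathcal{A}}(v)$ is the system of all sets $B=\bigcup_{k=1}^\infty B_k$ where $B_k\in\tilde{\mathcal{A}}(v,\varepsilon_k)$ for some $\varepsilon_k>0$. A sequence $(v_n)_n\subset X\setminus\{0\}$ is complete if its closed linear span is $X$. $\tilde{\mathcal{A}}$ is the system of those $B\subset X$ that, for every complete sequence $(v_n)_n$ in $X$, can be written as $B=\bigcup_{n=1}^\infty B_n$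 with $B_n\in\tilde{\mathcal{A}}(v_n)$ for each $n$. *)

theory Defs
  imports "HOL-Analysis.Analysis"
begin

section \<open>The Radon-Nikodym property\<close>

text \<open>
  The library predicate \<^const>\<open>has_bochner_integral\<close> is restricted to second countable value
  spaces. The Banach space \<open>Y\<close> below need not be separable, so the same definition is
  repeated here without that restriction; the lemma after it shows that the two agree where both
  make sense. Approximability by simple functions forces \<open>g\<close> to be almost everywhere separably
  valued, so this is the usual Bochner integral.
\<close>

definition has_Bochner_int :: "'w measure \<Rightarrow> ('w \<Rightarrow> 'b::banach) \<Rightarrow> 'b \<Rightarrow> bool" where
  "has_Bochner_int M g y \<longleftrightarrow>
     g \<in> borel_measurable M \<and>
     (\<exists>s. (\<forall>i. Bochner_Integration.simple_bochner_integrable M (s i)) \<and>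
          (\<lambda>i. \<integral>\<^sup>+ x. ennreal (norm (g x - s i x)) \<partial>M) \<longlonglongrightarrow> 0 \<and>
          (\<lambda>i. Bochner_Integration.simple_bochner_integral M (s i)) \<longlonglongrightarrow> y)"

lemma has_Bochner_int_iff_has_bochner_integral:
  fixes g :: "'w \<Rightarrow> 'b::{banach, second_countable_topology}"
  shows "has_Bochner_int M g y \<longleftrightarrow> has_bochner_integral M g y"
  unfolding has_Bochner_int_def has_bochner_integral.simps by blast

definition vector_measure :: "'w measure \<Rightarrow> ('w set \<Rightarrow> 'b::banach) \<Rightarrow> bool" where
  "vector_measure M G \<longleftrightarrow>
     (\<forall>A :: nat \<Rightarrow> 'w set. range A \<subseteq> sets M \<longrightarrow> disjoint_family A \<longrightarrow>
        (\<lambda>i. G (A i)) sums G (\<Union>i. A i))"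

definition bounded_variation_measure :: "'w measure \<Rightarrow> ('w set \<Rightarrow> 'b::banach) \<Rightarrow> bool" where
  "bounded_variation_measure M G \<longleftrightarrow>
     (\<exists>C. \<forall>P. finite P \<and> P \<subseteq> sets M \<and> partition_on (space M) P \<longrightarrow>
        (\<Sum>A\<in>P. norm (G A)) \<le> C)"

definition vanishes_on_null_sets :: "'w measure \<Rightarrow> ('w set \<Rightarrow> 'b::banach) \<Rightarrow> bool" where
  "vanishes_on_null_sets M G \<longleftrightarrow> (\<forall>A\<in>null_sets M. G A = 0)"

text \<open>
  HOL cannot quantify over all measure spaces of all types inside a definition. All finite measures
  on arbitrary sigma-algebras of sets of reals are allowed here. This includes Lebesgue measure
  on the unit interval, which is already known to be a sufficient test for the property over all
  finite measure spaces, so nothing is lost by fixing the type.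
\<close>

definition radon_nikodym_property :: "'b::banach itself \<Rightarrow> bool" where
  "radon_nikodym_property (_ :: 'b itself) \<longleftrightarrow>
     (\<forall>(M :: real measure) (G :: real set \<Rightarrow> 'b).
        finite_measure M \<and> vector_measure M G \<and> bounded_variation_measure M G \<and>
        vanishes_on_null_sets M G \<longrightarrow>
        (\<exists>g. \<forall>A\<in>sets M. has_Bochner_int M (\<lambda>x. indicator A x *\<^sub>R g x) (G A)))"

section \<open>Pointwise Lipschitz points and Gateaux differentiability\<close>

definition pointwise_lipschitz_at ::
    "('a::real_normed_vector \<Rightarrow> 'b::real_normed_vector) \<Rightarrow> 'a \<Rightarrow> bool" where
  "pointwise_lipschitz_at f x \<longleftrightarrow>
     Limsup (at x) (\<lambda>y. ereal (norm (f x - f y) / norm (x - y))) < \<infinity>"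

definition lipschitz_points ::
    "('a::real_normed_vector \<Rightarrow> 'b::real_normed_vector) \<Rightarrow> 'a set" where
  "lipschitz_points f = {x. pointwise_lipschitz_at f x}"

definition has_directional_derivative ::
    "('a::real_normed_vector \<Rightarrow> 'b::real_normed_vector) \<Rightarrow> 'a \<Rightarrow> 'a \<Rightarrow> 'b \<Rightarrow> bool" where
  "has_directional_derivative f x v d \<longleftrightarrow>
     ((\<lambda>t::real. (f (x + t *\<^sub>R v) - f x) /\<^sub>R t) \<longlongrightarrow> d) (at 0)"

definition gateaux_differentiable_at ::
    "('a::real_normed_vector \<Rightarrow> 'b::real_normed_vector) \<Rightarrow> 'a \<Rightarrow> bool" where
  "gateaux_differentiable_at f x \<longleftrightarrow>
     (\<exists>L. bounded_linear L \<and> (\<forall>v. has_directional_derivative f x v (L v)))"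

section \<open>The exceptional sets\<close>

text \<open>
  \<open>Atilde_eps\<close>, \<open>Atilde_dir\<close> and \<open>Atilde\<close> stand for $\tilde{\mathcal A}(v,\varepsilon)$,
  $\tilde{\mathcal A}(v)$ and $\tilde{\mathcal A}$. The first two are only meant for
  \<open>v \<noteq> 0\<close> and \<open>\<epsilon> > 0\<close>. Sequences are indexed from 0.
\<close>

definition Atilde_eps :: "'a::real_normed_vector \<Rightarrow> real \<Rightarrow> 'a set set" where
  "Atilde_eps v \<epsilon> =
     {B \<in> sets borel. \<forall>\<phi> :: real \<Rightarrow> 'a.
        \<epsilon>-lipschitz_on UNIV (\<lambda>t. \<phi> t - t *\<^sub>R v) \<longrightarrow> {t. \<phi> t \<in> B} \<in> null_sets lebesgue}"

definition Atilde_dir :: "'a::real_normed_vector \<Rightarrow> 'a set set" where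
  "Atilde_dir v =
     {B. \<exists>(Bk :: nat \<Rightarrow> 'a set) (\<epsilon> :: nat \<Rightarrow> real).
        (\<forall>k. \<epsilon> k > 0 \<and> Bk k \<in> Atilde_eps v (\<epsilon> k)) \<and> B = (\<Union>k. Bk k)}"

definition complete_sequence :: "(nat \<Rightarrow> 'a::real_normed_vector) \<Rightarrow> bool" where
  "complete_sequence v \<longleftrightarrow> (\<forall>n. v n \<noteq> 0) \<and> closure (span (range v)) = UNIV"

definition Atilde :: "'a::real_normed_vector set set" where
  "Atilde =
     {B. \<forall>v :: nat \<Rightarrow> 'a. complete_sequence v \<longrightarrow>
        (\<exists>Bn :: nat \<Rightarrow> 'a set. (\<forall>n. Bn n \<in> Atilde_dir (v n)) \<and> B = (\<Union>n. Bn n))}"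

end

theory Submission
  imports
    Defs
begin

text \<open>
  The whole argument is about the graph of \<open>f\<close>, not about its difference quotients. The set of
  points at which \<open>f\<close> is pointwise Lipschitz is a countable union of closed sets \<open>A\<close> such that
  \<open>f\<close> is Lipschitz on \<open>A\<close> and \<open>\<parallel>f y - f z\<parallel> \<le> L * \<parallel>y - z\<parallel>\<close> whenever \<open>z \<in> A\<close> and \<open>y\<close> is any
  nearby point of the space. Let \<open>\<Gamma> C\<close> be the graph of \<open>f\<close> over \<open>C \<subseteq> A\<close>. Then \<open>f\<close> has the Gateaux
  derivative \<open>D\<close> at \<open>x \<in> A\<close> as soon as, for every \<open>u\<close>, the distance of \<open>(x, f x) + s (u, D u)\<close> from
  \<open>\<Gamma> A\<close> is \<open>o(s)\<close>: nearby points of \<open>A\<close> carry the information about \<open>f (x + s u)\<close>. This reformulation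
  (\<open>nearly_tangent\<close>) has two benefits. Its defining condition is closed in \<open>x \<in> A\<close>, so all sets that occur are
  Borel although \<open>f\<close> is arbitrary outside \<open>A\<close>; and tangency to \<open>(u, y)\<close> and to \<open>(w, y')\<close> can be chained,
  by walking on the graph in two steps, to tangency to \<open>(u + w, y + y')\<close>.

  For the vectors of a complete sequence, approximate tangency comes from curves
  (\<open>nearly_tangent_along_curve\<close>). If \<open>\<phi> t - t v\<close> has a small Lipschitz constant, then \<open>f \<circ> \<phi>\<close> is
  Lipschitz on the closed set \<open>\<phi> -` A\<close>; it extends to a Lipschitz function on the line, which is
  differentiable almost everywhere by the Radon-Nikodym property. At a density point of
  \<open>\<phi> -` C\<close> where it is differentiable with derivative \<open>y\<close>, the points \<open>\<phi> t'\<close> show that \<open>\<Gamma> C\<close> is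
  nearly tangent to \<open>(v, y)\<close>, up to an error controlled by the Lipschitz constant of \<open>\<phi> t - t v\<close>.

  The passage from the vectors \<open>v n\<close> to arbitrary directions (\<open>ae_nearly_tangent_pair\<close>) relies on
  the fact that the set \<open>C\<close> above is an arbitrary Borel subset of \<open>A\<close>. Split \<open>C\<close>, up to a
  negligible set, into countably many pieces \<open>C1\<close> on which near tangency of \<open>\<Gamma> C\<close> to some fixed \<open>(u, y)\<close> holds
  up to a uniform scale, and apply the statement for \<open>w\<close> to each \<open>C1\<close>: from a remaining point of \<open>C1\<close>
  one first reaches \<open>\<Gamma> C1\<close> in direction \<open>(w, y')\<close> and from there \<open>\<Gamma> C\<close> in direction \<open>(u, y)\<close>. So the
  good directions form a linear space; it is closed, and hence everything. The slopes found in this way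
  are additive by construction, which yields existence and linearity of the derivative together
  (\<open>tangent_map_exists\<close>).

  The differentiability theorem for curves (\<open>rnp_lipschitz_ae_differentiable\<close>) is the classical
  one: the increments of a Lipschitz function extend to a vector measure of bounded variation that is
  absolutely continuous with respect to Lebesgue measure, and the function is differentiable, with
  derivative the density, at the Lebesgue points of that density.
\<close>

section \<open>Lebesgue points on the line\<close>

text \<open>
  Averages over intervals to the right of \<open>t\<close> are treated by the library theorem; reflecting
  \<open>f\<close> gives those to the left, and an interval around \<open>t\<close> is cut at \<open>t\<close>.
\<close>

lemma lebesgue_differentiation_straddle:
  fixes f :: "real \<Rightarrow> real"
  assumes int: "\<And>a b. f integrable_on {a..b}"
  obtains N where "negligible N"
    and "\<And>t e. t \<notin> N \<Longrightarrow> e > 0 \<Longrightarrow> \<exists>d>0. \<forall>a b. a \<le> t \<and> t \<le> b \<and> b - a < d \<longrightarrow>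
          \<bar>integral {a..b} f - (b - a) * f t\<bar> \<le> e * (b - a)"
proof -
  obtain N1 where N1: "negligible N1"
    and D1: "\<And>x e. \<lbrakk>x \<notin> N1; 0 < e\<rbrakk> \<Longrightarrow> \<exists>d>0. \<forall>h. 0 < h \<and> h < d \<longrightarrow>
                         norm (integral {x..x + h} f /\<^sub>R h - f x) < e"
    using integrable_ccontinuous_explicit[of f] int by (auto simp: cbox_interval)
  have int': "(\<lambda>x. f (- x)) integrable_on {a..b}" for a b
    using int[of "-b" "-a"] Henstock_Kurzweil_Integration.integrable_reflect_real[of f "-a" "-b"]
    by simp
  obtain N2 where N2: "negligible N2"
    and D2: "\<And>x e. \<lbrakk>x \<notin> N2; 0 < e\<rbrakk> \<Longrightarrow> \<exists>d>0. \<forall>h. 0 < h \<and> h < d \<longrightarrow>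
                         norm (integral {x..x + h} (\<lambda>x. f (- x)) /\<^sub>R h - f (- x)) < e"
    using integrable_ccontinuous_explicit[of "\<lambda>x. f (- x)"] int' by (auto simp: cbox_interval)
  have "negligible (uminus ` N2)"
  proof (rule negligible_locally_Lipschitz_image)
    fix x assume "x \<in> N2"
    have "norm (- y - - x) \<le> 1 * norm (y - x)" for y by (simp add: abs_minus_commute)
    then show "\<exists>T B. open T \<and> x \<in> T \<and> (\<forall>y\<in>N2 \<inter> T. norm (- y - - x) \<le> B * norm (y - x))"
      by (intro exI[of _ UNIV] exI[of _ 1]) auto
  qed (use N2 in auto)
  then have neg: "negligible (N1 \<union> uminus ` N2)"
    using N1 by (simp add: negligible_Un)
  have scale: "\<bar>I - h * y\<bar> \<le> e * h" if "norm (I /\<^sub>R h - y) < e" "h > 0" for I h y e :: real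
  proof -
    have "\<bar>I - h * y\<bar> = h * norm (I /\<^sub>R h - y)"
      using that(2) by (simp add: abs_mult_pos' field_simps)
    then show ?thesis
      using that by (simp add: mult.commute mult_left_mono)
  qed
  show thesis
  proof
    show "negligible (N1 \<union> uminus ` N2)" by (fact neg)
    fix t e :: real assume t: "t \<notin> N1 \<union> uminus ` N2" and e: "e > 0"
    from t have t1: "t \<notin> N1" and t2: "- t \<notin> N2" by force+
    obtain d1 where d1: "d1 > 0" and R: "\<And>h. 0 < h \<Longrightarrow> h < d1 \<Longrightarrow>
        norm (integral {t..t + h} f /\<^sub>R h - f t) < e"
      using D1[OF t1 e] by blast
    obtain d2 where d2: "d2 > 0" and L: "\<And>h. 0 < h \<Longrightarrow> h < d2 \<Longrightarrow>
        norm (integral {- t..- t + h} (\<lambda>x. f (- x)) /\<^sub>R h - f t) < e"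
      using D2[OF t2 e] by auto
    have R': "\<bar>integral {t..b} f - (b - t) * f t\<bar> \<le> e * (b - t)" if "t \<le> b" "b - t < d1" for b
      using scale[OF R[of "b - t"]] that by (cases "b = t") auto
    have L': "\<bar>integral {a..t} f - (t - a) * f t\<bar> \<le> e * (t - a)" if "a \<le> t" "t - a < d2" for a
      using scale[OF L[of "t - a"]] that Henstock_Kurzweil_Integration.integral_reflect_real[of t a f]
      by (cases "a = t") auto
    show "\<exists>d>0. \<forall>a b. a \<le> t \<and> t \<le> b \<and> b - a < d \<longrightarrow>
          \<bar>integral {a..b} f - (b - a) * f t\<bar> \<le> e * (b - a)"
    proof (intro exI[of _ "min d1 d2"] conjI allI impI)
      show "min d1 d2 > 0" using d1 d2 by simp
      fix a b assume ab: "a \<le> t \<and> t \<le> b \<and> b - a < min d1 d2"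
      have "integral {a..b} f = integral {a..t} f + integral {t..b} f"
        using ab int by (simp add: Henstock_Kurzweil_Integration.integral_combine)
      moreover have "\<bar>integral {t..b} f - (b - t) * f t\<bar> \<le> e * (b - t)"
        using ab by (intro R') auto
      moreover have "\<bar>integral {a..t} f - (t - a) * f t\<bar> \<le> e * (t - a)"
        using ab by (intro L') auto
      ultimately show "\<bar>integral {a..b} f - (b - a) * f t\<bar> \<le> e * (b - a)"
        by (simp add: algebra_simps)
    qed
  qed
qed

text \<open>
  At a Lebesgue density point, a gap of relative length \<open>\<delta>\<close> at distance \<open>\<bar>s\<bar>\<close> would
  remove the fraction \<open>\<delta>\<close> of the interval from \<open>t\<close> to \<open>t + s\<close>.
\<close>

lemma ae_density_approach:
  fixes S :: "real set"
  assumes S: "S \<in> sets lebesgue"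
  obtains N where "negligible N"
    and "\<And>t \<delta>. t \<in> S - N \<Longrightarrow> \<delta> > 0 \<Longrightarrow>
          \<exists>d>0. \<forall>s. \<bar>s\<bar> < d \<longrightarrow> (\<exists>t'\<in>S. \<bar>t' - (t + s)\<bar> \<le> \<delta> * \<bar>s\<bar>)"
proof -
  have int: "indicat_real S integrable_on {a..b}" for a b
  proof -
    have "S \<inter> {a..b} \<in> lmeasurable"
      using S by (intro bounded_set_imp_lmeasurable) (auto intro: bounded_subset[of "{a..b}"])
    then show ?thesis
      using integrable_on_indicator by (metis inf_commute)
  qed
  obtain N where N: "negligible N"
    and D: "\<And>t e. t \<notin> N \<Longrightarrow> e > 0 \<Longrightarrow> \<exists>d>0. \<forall>a b. a \<le> t \<and> t \<le> b \<and> b - a < d \<longrightarrow>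
          \<bar>integral {a..b} (indicat_real S) - (b - a) * indicat_real S t\<bar> \<le> e * (b - a)"
    using lebesgue_differentiation_straddle[OF int] by blast
  show thesis
  proof
    show "negligible N" by (fact N)
    fix t \<delta> :: real assume t: "t \<in> S - N" and "\<delta> > 0"
    define \<epsilon> where "\<epsilon> = min \<delta> (1/2)"
    have \<epsilon>: "\<epsilon> > 0" "\<epsilon> < 1" "\<epsilon> \<le> \<delta>" using \<open>\<delta> > 0\<close> by (auto simp: \<epsilon>_def)
    obtain d where d: "d > 0" and dd: "\<And>a b. a \<le> t \<Longrightarrow> t \<le> b \<Longrightarrow> b - a < d \<Longrightarrow>
          \<bar>integral {a..b} (indicat_real S) - (b - a)\<bar> \<le> \<epsilon> / 2 * (b - a)"
      using D[of t "\<epsilon>/2"] t \<epsilon> by auto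
    have "\<exists>t'\<in>S. \<bar>t' - (t + s)\<bar> \<le> \<epsilon> * \<bar>s\<bar>" if s: "\<bar>s\<bar> < d" for s
    proof (cases "s = 0")
      case True then show ?thesis using t by auto
    next
      case False
      show ?thesis
      proof (rule ccontr)
        assume no: "\<not> ?thesis"
        define a b where "a = min t (t + s)" and "b = max t (t + s)"
        define a' b' where "a' = (if s > 0 then t else t + s + \<epsilon> * \<bar>s\<bar>)"
          and "b' = (if s > 0 then t + s - \<epsilon> * \<bar>s\<bar> else t)"
        have len: "b - a = \<bar>s\<bar>" by (auto simp: a_def b_def)
        have es: "\<epsilon> * \<bar>s\<bar> < \<bar>s\<bar>" using False \<epsilon> by simp
        have len': "b' - a' = \<bar>s\<bar> - \<epsilon> * \<bar>s\<bar>" using False by (auto simp: a'_def b'_def)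
        have sub: "x \<in> {a'..b'}" if "x \<in> S" "x \<in> {a..b}" for x
        proof (rule ccontr)
          assume x: "x \<notin> {a'..b'}"
          have "\<bar>x - (t + s)\<bar> \<le> \<epsilon> * \<bar>s\<bar>"
            using that x by (auto simp: a_def b_def a'_def b'_def abs_if split: if_splits)
          with no that show False by auto
        qed
        have ab': "a \<le> a'" "b' \<le> b" "a' \<le> b'" using es \<epsilon>
          mult_nonneg_nonneg[of \<epsilon> "\<bar>s\<bar>"]
          by (auto simp: a_def b_def a'_def b'_def not_less abs_if simp del: mult_nonneg_nonneg split: if_splits)
        have "integral {a..b} (indicat_real S) \<le> integral {a..b} (indicat_real {a'..b'})"
          using sub by (intro integral_le int) (auto simp: indicator_def integrable_on_indicator
              intro: integrable_on_indicator[THEN iffD2])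
        also have "\<dots> = measure lebesgue ({a'..b'} \<inter> {a..b})"
          by (rule integral_indicator) auto
        also have "{a'..b'} \<inter> {a..b} = {a'..b'}" using ab' by auto
        also have "measure lebesgue {a'..b'} = \<bar>s\<bar> - \<epsilon> * \<bar>s\<bar>"
          using ab' len' by simp
        finally have "integral {a..b} (indicat_real S) \<le> \<bar>s\<bar> - \<epsilon> * \<bar>s\<bar>" .
        moreover have "\<bar>integral {a..b} (indicat_real S) - \<bar>s\<bar>\<bar> \<le> \<epsilon> / 2 * \<bar>s\<bar>"
          using dd[of a b] s len by (auto simp: a_def b_def)
        moreover have "\<epsilon> * \<bar>s\<bar> > 0" using False \<epsilon> by simp
        ultimately show False by simp
      qed
    qed
    then show "\<exists>d>0. \<forall>s. \<bar>s\<bar> < d \<longrightarrow> (\<exists>t'\<in>S. \<bar>t' - (t + s)\<bar> \<le> \<delta> * \<bar>s\<bar>)"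
      using d \<epsilon>(3) by (meson abs_ge_zero mult_right_mono order_trans)
  qed
qed

section \<open>The vector measure of a Lipschitz function\<close>

definition unit_leb :: "real measure" where
  "unit_leb = density lborel (indicator {0<..1})"

lemma space_unit_leb [simp]: "space unit_leb = UNIV"
  by (simp add: unit_leb_def)

lemma sets_unit_leb [simp, measurable_cong]: "sets unit_leb = sets borel"
  by (simp add: unit_leb_def)

lemma emeasure_unit_leb:
  "B \<in> sets borel \<Longrightarrow> emeasure unit_leb B = emeasure lborel (B \<inter> {0<..1})"
  by (simp add: unit_leb_def emeasure_density indicator_inter_arith[symmetric] Int_commute)

interpretation unit_leb: finite_measure unit_leb
  by standard (simp add: emeasure_unit_leb)

lemma measure_unit_leb_interval:
  "0 \<le> a \<Longrightarrow> a \<le> b \<Longrightarrow> b \<le> 1 \<Longrightarrow> measure unit_leb {a<..b} = b - a"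
proof -
  assume "0 \<le> a" "a \<le> b" "b \<le> 1"
  then have "{a<..b} \<inter> {0<..1} = {a<..b}" by auto
  then show ?thesis using \<open>a \<le> b\<close> by (simp add: measure_def emeasure_unit_leb)
qed

definition dyadic_cell :: "nat \<Rightarrow> nat \<Rightarrow> real set" where
  "dyadic_cell k j = {real j / 2 ^ k<..real (Suc j) / 2 ^ k}"

text \<open>
  The integral over \<open>B \<inter> {0<..1}\<close> of the derivative of the function that interpolates \<open>g\<close> linearly between
  the dyadic points of level \<open>k\<close>. The vector measure of \<open>g\<close> is its limit as \<open>k\<close> grows; working with
  finite sums avoids an integral for functions whose values lie in a non-separable space.
\<close>

definition dyadic_increments :: "(real \<Rightarrow> 'b::real_normed_vector) \<Rightarrow> nat \<Rightarrow> real set \<Rightarrow> 'b" where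
  "dyadic_increments g k B = (\<Sum>j<2 ^ k. (2 ^ k * measure unit_leb (B \<inter> dyadic_cell k j)) *\<^sub>R
      (g (real (Suc j) / 2 ^ k) - g (real j / 2 ^ k)))"

lemma dyadic_cell_borel [measurable, simp]: "dyadic_cell k j \<in> sets borel"
  by (simp add: dyadic_cell_def)

lemma dyadic_cell_mem: "x \<in> dyadic_cell k j \<Longrightarrow> real j < x * 2 ^ k \<and> x * 2 ^ k \<le> real j + 1"
  by (simp add: dyadic_cell_def field_simps)

lemma disjoint_dyadic_cells: "disjoint_family (dyadic_cell k)"
proof (clarsimp simp: disjoint_family_on_def)
  fix i j :: nat assume "i \<noteq> j"
  { fix x assume "x \<in> dyadic_cell k i" "x \<in> dyadic_cell k j"
    then have "real i < real j + 1" "real j < real i + 1"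
      using dyadic_cell_mem[of x k i] dyadic_cell_mem[of x k j] by linarith+
    then have False using \<open>i \<noteq> j\<close> by linarith }
  then show "dyadic_cell k i \<inter> dyadic_cell k j = {}" by auto
qed

lemma measure_dyadic_cell: "j < 2 ^ k \<Longrightarrow> measure unit_leb (dyadic_cell k j) = 1 / 2 ^ k"
proof -
  assume j: "j < 2 ^ k"
  then have "Suc j \<le> 2 ^ k" by simp
  then have "real (Suc j) \<le> 2 ^ k" by (metis of_nat_le_iff of_nat_numeral of_nat_power)
  then show ?thesis unfolding dyadic_cell_def
    by (subst measure_unit_leb_interval) (auto simp: field_simps)
qed

lemma dyadic_increments_Un:
  assumes [measurable]: "A \<in> sets borel" "B \<in> sets borel" and "A \<inter> B = {}"
  shows "dyadic_increments g k (A \<union> B) = dyadic_increments g k A + dyadic_increments g k B"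
proof -
  have "measure unit_leb ((A \<union> B) \<inter> D) = measure unit_leb (A \<inter> D) + measure unit_leb (B \<inter> D)"
    if [measurable]: "D \<in> sets borel" for D
    unfolding Int_Un_distrib2 using assms(3) by (intro unit_leb.finite_measure_Union) auto
  then show ?thesis
    by (simp add: dyadic_increments_def sum.distrib[symmetric] algebra_simps)
qed

lemma norm_dyadic_increments_le:
  assumes g: "C-lipschitz_on UNIV g" and [measurable]: "B \<in> sets borel"
  shows "norm (dyadic_increments g k B) \<le> C * measure unit_leb B"
proof -
  have C: "C \<ge> 0" using g by (rule lipschitz_on_nonneg)
  have inc: "norm (g (real (Suc j) / 2 ^ k) - g (real j / 2 ^ k)) \<le> C * (1 / 2 ^ k)" for j
    using lipschitz_on_normD[OF g, of "real (Suc j) / 2 ^ k" "real j / 2 ^ k"]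
    by (simp add: diff_divide_distrib[symmetric])
  have "norm (dyadic_increments g k B) \<le> (\<Sum>j<2 ^ k. C * measure unit_leb (B \<inter> dyadic_cell k j))"
    unfolding dyadic_increments_def
  proof (rule sum_norm_le)
    fix j assume "j \<in> {..<2 ^ k :: nat}"
    have "norm ((2 ^ k * measure unit_leb (B \<inter> dyadic_cell k j)) *\<^sub>R
      (g (real (Suc j) / 2 ^ k) - g (real j / 2 ^ k))) \<le>
      (2 ^ k * measure unit_leb (B \<inter> dyadic_cell k j)) * (C * (1 / 2 ^ k))"
      unfolding norm_scaleR using inc by (intro mult_mono) auto
    also have "\<dots> = C * measure unit_leb (B \<inter> dyadic_cell k j)" by simp
    finally show "norm ((2 ^ k * measure unit_leb (B \<inter> dyadic_cell k j)) *\<^sub>R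
      (g (real (Suc j) / 2 ^ k) - g (real j / 2 ^ k))) \<le> C * measure unit_leb (B \<inter> dyadic_cell k j)" .
  qed
  also have "\<dots> = C * measure unit_leb (\<Union>j<2 ^ k. B \<inter> dyadic_cell k j)"
    unfolding sum_distrib_left[symmetric]
    using disjoint_dyadic_cells[of k]
    by (subst unit_leb.finite_measure_finite_Union) (auto simp: disjoint_family_on_def)
  also have "\<dots> \<le> C * measure unit_leb B"
    using C by (intro mult_left_mono unit_leb.finite_measure_mono) auto
  finally show ?thesis .
qed

lemma dyadic_increments_atMost:
  assumes "m \<le> 2 ^ k"
  shows "dyadic_increments g k {..real m / 2 ^ k} = g (real m / 2 ^ k) - g 0"
proof -
  have cell: "{..real m / 2 ^ k} \<inter> dyadic_cell k j = (if j < m then dyadic_cell k j else {})" for j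
  proof (cases "j < m")
    case True
    then have "real (Suc j) \<le> real m" by simp
    then have "real (Suc j) / 2 ^ k \<le> real m / 2 ^ k" by (simp add: divide_right_mono)
    then show ?thesis using True by (auto simp: dyadic_cell_def)
  next
    case False
    then have "real m / 2 ^ k \<le> real j / 2 ^ k" by (simp add: divide_right_mono)
    then show ?thesis using False by (auto simp: dyadic_cell_def)
  qed
  have "dyadic_increments g k {..real m / 2 ^ k} =
      (\<Sum>j<2 ^ k. if j < m then g (real (Suc j) / 2 ^ k) - g (real j / 2 ^ k) else 0)"
    unfolding dyadic_increments_def
    by (rule sum.cong) (auto simp: cell measure_dyadic_cell)
  also have "\<dots> = (\<Sum>j<m. g (real (Suc j) / 2 ^ k) - g (real j / 2 ^ k))"
    using assms by (intro sum.mono_neutral_cong_right) auto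
  also have "\<dots> = g (real m / 2 ^ k) - g 0"
    using sum_lessThan_telescope[of "\<lambda>j. g (real j / 2 ^ k)" m] by simp
  finally show ?thesis .
qed

text \<open>
  The dyadic point of level \<open>k\<close> just below \<open>x\<close> gives an exact increment of \<open>g\<close>; the remaining
  interval contributes at most \<open>C\<close> times its length to both sides.
\<close>

lemma dyadic_increments_tendsto:
  assumes g: "C-lipschitz_on UNIV g" and x: "0 \<le> x" "x \<le> 1"
  shows "(\<lambda>k. dyadic_increments g k {..x}) \<longlonglongrightarrow> g x - g 0"
proof -
  have C: "C \<ge> 0" using g by (rule lipschitz_on_nonneg)
  have bound: "norm (dyadic_increments g k {..x} - (g x - g 0)) \<le> 2 * C * (1 / 2) ^ k" for k
  proof -
    define m where "m = nat \<lfloor>x * 2 ^ k\<rfloor>"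
    have m: "real m \<le> x * 2 ^ k" "x * 2 ^ k < real m + 1"
      using x unfolding m_def by (simp_all add: of_nat_nat) 
    let ?p = "real m / 2 ^ k"
    have p: "?p \<le> x" "x - ?p \<le> (1/2) ^ k" "0 \<le> ?p"
      using m by (simp_all add: power_divide divide_le_eq le_divide_eq left_diff_distrib)
    have "real m \<le> 2 ^ k" using m(1) x(2)
      by (meson mult_left_le_one_le order_trans x(1) zero_le_numeral zero_le_power)
    then have m2: "m \<le> 2 ^ k" by (metis of_nat_le_iff of_nat_numeral of_nat_power)
    have "{..x} = {..?p} \<union> {?p<..x}" using p by auto
    then have "dyadic_increments g k {..x} = (g ?p - g 0) + dyadic_increments g k {?p<..x}"
      using dyadic_increments_Un[of "{..?p}" "{?p<..x}" g k] dyadic_increments_atMost[OF m2, of g]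
      by fastforce
    then have "norm (dyadic_increments g k {..x} - (g x - g 0))
        = norm (dyadic_increments g k {?p<..x} - (g x - g ?p))" by (simp add: algebra_simps)
    also have "\<dots> \<le> C * measure unit_leb {?p<..x} + C * norm (x - ?p)"
      by (intro order_trans[OF norm_triangle_ineq4] add_mono norm_dyadic_increments_le[OF g]
          lipschitz_on_normD[OF g]) auto
    also have "\<dots> = 2 * C * (x - ?p)"
      using p x by (subst measure_unit_leb_interval) auto
    also have "\<dots> \<le> 2 * C * (1/2) ^ k" using p C by (intro mult_left_mono) auto
    finally show ?thesis .
  qed
  have "(\<lambda>k. 2 * C * (1 / 2) ^ k) \<longlonglongrightarrow> 2 * C * 0"
    by (intro tendsto_intros LIMSEQ_realpow_zero) auto
  then have "(\<lambda>k. 2 * C * (1 / 2) ^ k) \<longlonglongrightarrow> 0" by simp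
  then have "(\<lambda>k. dyadic_increments g k {..x} - (g x - g 0)) \<longlonglongrightarrow> 0"
    by (rule Lim_null_comparison[rotated]) (use bound in auto)
  then show ?thesis by (simp add: LIM_zero_iff)
qed

lemma measure_disjoint_tail:
  fixes A :: "nat \<Rightarrow> real set"
  assumes A: "disjoint_family A" "range A \<subseteq> sets borel"
  shows "(\<lambda>n. measure unit_leb (\<Union>i. A (i + n))) \<longlonglongrightarrow> 0"
proof -
  have [measurable]: "A i \<in> sets borel" for i using A by auto
  have "decseq (\<lambda>n. \<Union>i. A (i + n))"
  proof (rule decseq_SucI, safe)
    fix n x i assume "x \<in> A (i + Suc n)"
    then show "x \<in> (\<Union>i. A (i + n))" by (auto intro!: exI[of _ "Suc i"])
  qed
  then have "(\<lambda>n. measure unit_leb (\<Union>i. A (i + n))) \<longlonglongrightarrow> measure unit_leb (\<Inter>n. \<Union>i. A (i + n))"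
    by (intro unit_leb.finite_Lim_measure_decseq) auto
  also have "(\<Inter>n. \<Union>i. A (i + n)) = {}"
  proof (rule ccontr)
    assume "\<not> ?thesis"
    then obtain x where "x \<in> (\<Inter>n. \<Union>i. A (i + n))" by blast
    then have x: "\<exists>i. x \<in> A (i + n)" for n by simp
    obtain i where i: "x \<in> A i" using x[of 0] by auto
    obtain j where "x \<in> A (j + Suc i)" using x[of "Suc i"] by blast
    moreover have "j + Suc i \<noteq> i" by simp
    ultimately show False using i disjoint_family_onD[OF A(1), of "j + Suc i" i] by auto
  qed
  finally show ?thesis by simp
qed

lemma UN_split_tail: "(\<Union>i. A i) = (\<Union>i<n. A i) \<union> (\<Union>i. A (i + n))" for A :: "nat \<Rightarrow> 'x set"
proof safe
  fix x i assume x: "x \<in> A i" "x \<notin> (\<Union>i. A (i + n))"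
  have "i < n"
  proof (rule ccontr)
    assume "\<not> i < n"
    then have "A i = A ((i - n) + n)" by simp
    then show False using x by blast
  qed
  then show "x \<in> (\<Union>i<n. A i)" using x by blast
qed auto

lemma disjoint_head_tail:
  fixes A :: "nat \<Rightarrow> 'x set"
  assumes "disjoint_family A"
  shows "(\<Union>i<n. A i) \<inter> (\<Union>i. A (i + n)) = {}"
proof -
  have "A i \<inter> A (j + n) = {}" if "i < n" for i j
    using disjoint_family_onD[OF assms, of i "j + n"] that by simp
  then show ?thesis by blast
qed

text \<open>
  Used both for the approximations \<open>dyadic_increments g k\<close> and for their limit.
\<close>

lemma finitely_additive_sum:
  fixes F :: "real set \<Rightarrow> 'b::real_normed_vector" and n :: nat
  assumes add: "\<And>A B. A \<in> sets borel \<Longrightarrow> B \<in> sets borel \<Longrightarrow> A \<inter> B = {} \<Longrightarrow> F (A \<union> B) = F A + F B"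
    and A: "disjoint_family A" "range A \<subseteq> sets borel"
  shows "F (\<Union>i<n. A i) = (\<Sum>i<n. F (A i))"
proof -
  have [measurable]: "A i \<in> sets borel" for i using A by auto
  have F0: "F {} = 0" using add[of "{}" "{}"] by simp
  show ?thesis
  proof (induction n)
    case (Suc n)
    have "A n \<inter> A i = {}" if "i < n" for i
      using disjoint_family_onD[OF A(1), of n i] that by simp
    then have "A n \<inter> (\<Union>i<n. A i) = {}" by blast
    then have "F (A n \<union> (\<Union>i<n. A i)) = F (A n) + F (\<Union>i<n. A i)"
      by (intro add) auto
    then show ?case using Suc by (simp add: lessThan_Suc add.commute)
  qed (simp add: F0)
qed

text \<open>
  A Dynkin class argument, starting from the half-lines. For a disjoint union, the bound
  by \<open>C * measure unit_leb B\<close> makes the tails small uniformly in \<open>k\<close>, so the sequence is Cauchy.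
\<close>

lemma convergent_dyadic_increments:
  fixes g :: "real \<Rightarrow> 'b::banach"
  assumes g: "C-lipschitz_on UNIV g" and B: "B \<in> sets borel"
  shows "convergent (\<lambda>k. dyadic_increments g k B)"
proof -
  let ?G = "dyadic_increments g"
  have C: "C \<ge> 0" using g by (rule lipschitz_on_nonneg)
  have gen: "sets borel = sigma_sets UNIV (range (\<lambda>a::real. {..a}))"
    by (subst borel_eq_atMost) (simp add: sets_measure_of)
  have null: "?G k B = 0" if "B \<in> sets borel" "measure unit_leb B = 0" for B k
    using norm_dyadic_increments_le[OF g that(1), of k] that(2) by simp
  have upto: "convergent (\<lambda>k. ?G k {..x})" for x
  proof -
    consider "x < 0" | "0 \<le> x" "x \<le> 1" | "x > 1" by linarith
    then show ?thesis
    proof cases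
      case 1
      have "{..x} \<inter> {0<..1} = {}" using 1 by auto
      then have "?G k {..x} = 0" for k
        by (intro null) (auto simp: measure_def emeasure_unit_leb)
      then show ?thesis by (simp add: convergent_const)
    next
      case 2
      then show ?thesis using dyadic_increments_tendsto[OF g] by (auto simp: convergent_def)
    next
      case 3
      have "{1<..x} \<inter> {0<..1} = {}" using 3 by auto
      then have z: "?G k {1<..x} = 0" for k
        by (intro null) (auto simp: measure_def emeasure_unit_leb)
      have "{..x} = {..1} \<union> {1<..x}" using 3 by auto
      then have "?G k {..x} = ?G k {..1} + ?G k {1<..x}" for k
        using dyadic_increments_Un[of "{..1}" "{1<..x}" g k] by fastforce
      then have "?G k {..x} = ?G k {..1}" for k using z by simp
      then show ?thesis using dyadic_increments_tendsto[OF g, of 1] by (auto simp: convergent_def)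
    qed
  qed
  have "Int_stable (range (\<lambda>a::real. {..a}))"
    by (auto simp: Int_stable_def)
  moreover have "range (\<lambda>a::real. {..a}) \<subseteq> Pow UNIV" by simp
  moreover have "B \<in> sigma_sets UNIV (range (\<lambda>a::real. {..a}))" using B gen by simp
  ultimately show ?thesis
  proof (induct rule: sigma_sets_induct_disjoint)
    case (basic A)
    then show ?case using upto by auto
  next
    case empty
    show ?case by (simp add: null convergent_const)
  next
    case (compl A)
    have A: "A \<in> sets borel" using compl gen by simp
    have "?G k (UNIV - A) = ?G k UNIV - ?G k A" for k
      using dyadic_increments_Un[of A "UNIV - A" g k] A by (simp add: algebra_simps)
    moreover have "?G k UNIV = ?G k {..1}" for k
    proof -
      have "{1<..} \<inter> {0<..1::real} = {}" by auto
      then have z: "?G k {1<..} = 0"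
        by (intro null) (auto simp: measure_def emeasure_unit_leb)
      have "(UNIV::real set) = {..1} \<union> {1<..}" by auto
      then show ?thesis
        using dyadic_increments_Un[of "{..1}" "{1<..}" g k] z by fastforce
    qed
    ultimately show ?case using convergent_diff[OF upto[of 1] compl(2)] by simp
  next
    case (union A)
    have A: "disjoint_family A" "range A \<subseteq> sets borel" using union gen by auto
    then have [measurable]: "A i \<in> sets borel" for i by auto
    have head: "convergent (\<lambda>k. ?G k (\<Union>i<n. A i))" for n
    proof -
      have "?G k (\<Union>i<n. A i) = (\<Sum>i<n. ?G k (A i))" for k
        by (rule finitely_additive_sum[where F="?G k" and A=A]) (use dyadic_increments_Un A in auto)
      then show ?thesis using union(3) by (auto intro!: convergent_sum)
    qed
    have split: "?G k (\<Union>i. A i) = ?G k (\<Union>i<n. A i) + ?G k (\<Union>i. A (i + n))" for k n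
    proof -
      show ?thesis
        unfolding UN_split_tail[of A n]
        by (intro dyadic_increments_Un disjoint_head_tail A) auto
    qed
    show ?case
    proof (rule Cauchy_convergent, rule metric_CauchyI)
      fix e :: real assume e: "e > 0"
      have "(\<lambda>n. C * measure unit_leb (\<Union>i. A (i + n))) \<longlonglongrightarrow> C * 0"
        by (intro tendsto_intros measure_disjoint_tail A)
      then have "eventually (\<lambda>n. C * measure unit_leb (\<Union>i. A (i + n)) < e / 3) sequentially"
        using e by (intro order_tendstoD(2)[of _ 0]) auto
      then obtain n where n: "C * measure unit_leb (\<Union>i. A (i + n)) < e / 3"
        by (auto simp: eventually_sequentially)
      have tail: "norm (?G k (\<Union>i. A (i + n))) < e / 3" for k
        using norm_dyadic_increments_le[OF g, of "\<Union>i. A (i + n)" k] n by auto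
      obtain K where K: "\<And>k l. k \<ge> K \<Longrightarrow> l \<ge> K \<Longrightarrow> dist (?G k (\<Union>i<n. A i)) (?G l (\<Union>i<n. A i)) < e / 3"
        using convergent_Cauchy[OF head[of n]] e unfolding Cauchy_def
        by (metis divide_pos_pos zero_less_numeral)
      show "\<exists>M. \<forall>k\<ge>M. \<forall>l\<ge>M. dist (?G k (\<Union>i. A i)) (?G l (\<Union>i. A i)) < e"
      proof (intro exI[of _ K] allI impI)
        fix k l assume "k \<ge> K" "l \<ge> K"
        let ?h = "\<lambda>k. ?G k (\<Union>i<n. A i)" and ?t = "\<lambda>k. ?G k (\<Union>i. A (i + n))"
        have "norm ((?h k + ?t k) - (?h l + ?t l)) \<le> norm (?h k - ?h l) + (norm (?t k) + norm (?t l))"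
        proof -
          have "(?h k + ?t k) - (?h l + ?t l) = (?h k - ?h l) + (?t k - ?t l)" by simp
          then have "norm ((?h k + ?t k) - (?h l + ?t l)) \<le> norm (?h k - ?h l) + norm (?t k - ?t l)"
            by (simp only: norm_triangle_ineq)
          then show ?thesis using norm_triangle_ineq4[of "?t k" "?t l"] by linarith
        qed
        also have "\<dots> < e"
          using K[OF \<open>k \<ge> K\<close> \<open>l \<ge> K\<close>] tail[of k] tail[of l] by (simp add: dist_norm)
        finally show "dist (?G k (\<Union>i. A i)) (?G l (\<Union>i. A i)) < e"
          unfolding split[of _ n] dist_norm .
      qed
    qed
  qed
qed

text \<open>
  The bound by \<open>C * measure unit_leb B\<close> survives the limit; it gives countable additivity, bounded
  variation and absolute continuity at once.
\<close>

lemma lipschitz_vector_measure: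
  fixes g :: "real \<Rightarrow> 'b::banach"
  assumes g: "C-lipschitz_on UNIV g"
  obtains G where "vector_measure unit_leb G" "bounded_variation_measure unit_leb G"
    "vanishes_on_null_sets unit_leb G"
    "\<And>a b. 0 \<le> a \<Longrightarrow> a \<le> b \<Longrightarrow> b \<le> 1 \<Longrightarrow> G {a<..b} = g b - g a"
proof -
  have C: "C \<ge> 0" using g by (rule lipschitz_on_nonneg)
  define G where "G B = lim (\<lambda>k. dyadic_increments g k B)" for B
  have G: "(\<lambda>k. dyadic_increments g k B) \<longlonglongrightarrow> G B" if "B \<in> sets borel" for B
    using convergent_dyadic_increments[OF g that] by (simp add: G_def convergent_LIMSEQ_iff)
  have add: "G (A \<union> B) = G A + G B" if "A \<in> sets borel" "B \<in> sets borel" "A \<inter> B = {}" for A B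
  proof (rule LIMSEQ_unique[OF G])
    show "(\<lambda>k. dyadic_increments g k (A \<union> B)) \<longlonglongrightarrow> G A + G B"
      unfolding dyadic_increments_Un[OF that] by (intro tendsto_intros G that)
  qed (use that in auto)
  have bound: "norm (G B) \<le> C * measure unit_leb B" if "B \<in> sets borel" for B
    by (rule LIMSEQ_le_const2[OF tendsto_norm[OF G[OF that]]])
       (use norm_dyadic_increments_le[OF g that] in auto)
  show thesis
  proof
    show "vector_measure unit_leb G"
      unfolding vector_measure_def
    proof (intro allI impI)
      fix A :: "nat \<Rightarrow> real set" assume "range A \<subseteq> sets unit_leb" and d: "disjoint_family A"
      then have A: "range A \<subseteq> sets borel" by simp
      then have [measurable]: "A i \<in> sets borel" for i by auto
      have "norm ((\<Sum>i<n. G (A i)) - G (\<Union>i. A i)) \<le> C * measure unit_leb (\<Union>i. A (i + n))" for n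
      proof -
        have "G (\<Union>i. A i) = G (\<Union>i<n. A i) + G (\<Union>i. A (i + n))"
          unfolding UN_split_tail[of A n]
          by (intro add disjoint_head_tail d) auto
        moreover have "G (\<Union>i<n. A i) = (\<Sum>i<n. G (A i))"
          by (rule finitely_additive_sum[where F=G and A=A]) (use add d A in auto)
        ultimately have "norm ((\<Sum>i<n. G (A i)) - G (\<Union>i. A i)) = norm (G (\<Union>i. A (i + n)))"
          by simp
        then show ?thesis using bound[of "\<Union>i. A (i + n)"] by auto
      qed
      then have le: "eventually (\<lambda>n. norm ((\<Sum>i<n. G (A i)) - G (\<Union>i. A i)) \<le>
          C * measure unit_leb (\<Union>i. A (i + n))) sequentially" by simp
      have "(\<lambda>n. C * measure unit_leb (\<Union>i. A (i + n))) \<longlonglongrightarrow> C * 0"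
        by (intro tendsto_intros measure_disjoint_tail d A)
      then have "(\<lambda>n. C * measure unit_leb (\<Union>i. A (i + n))) \<longlonglongrightarrow> 0" by simp
      then have "(\<lambda>n. (\<Sum>i<n. G (A i)) - G (\<Union>i. A i)) \<longlonglongrightarrow> 0"
        by (rule Lim_null_comparison[OF le])
      then show "(\<lambda>i. G (A i)) sums G (\<Union>i. A i)"
        by (simp add: sums_def LIM_zero_iff)
    qed
    show "bounded_variation_measure unit_leb G"
      unfolding bounded_variation_measure_def
    proof (intro exI allI impI)
      fix P assume "finite P \<and> P \<subseteq> sets unit_leb \<and> partition_on (space unit_leb) P"
      then have P: "finite P" "P \<subseteq> sets borel" "disjoint P"
        by (auto simp: partition_on_def)
      have "(\<Sum>A\<in>P. norm (G A)) \<le> (\<Sum>A\<in>P. C * measure unit_leb A)"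
        using P by (intro sum_mono bound) auto
      also have "\<dots> = C * measure unit_leb (\<Union>A\<in>P. A)"
        unfolding sum_distrib_left[symmetric]
        using P by (subst unit_leb.finite_measure_finite_Union)
           (auto simp: disjoint_family_on_def disjoint_def)
      also have "\<dots> \<le> C * measure unit_leb UNIV"
        using C by (intro mult_left_mono unit_leb.finite_measure_mono) auto
      finally show "(\<Sum>A\<in>P. norm (G A)) \<le> C * measure unit_leb UNIV" .
    qed
    show "vanishes_on_null_sets unit_leb G"
      unfolding vanishes_on_null_sets_def
    proof
      fix A assume A: "A \<in> null_sets unit_leb"
      then have "A \<in> sets borel" "measure unit_leb A = 0"
        by (auto simp: null_sets_def measure_def)
      then show "G A = 0" using bound[of A] by simp
    qed
    fix a b :: real assume ab: "0 \<le> a" "a \<le> b" "b \<le> 1"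
    have upto: "G {..x} = g x - g 0" if "0 \<le> x" "x \<le> 1" for x
      by (rule LIMSEQ_unique[OF G dyadic_increments_tendsto[OF g that]]) auto
    have "{..b} = {..a} \<union> {a<..b}" using ab by auto
    then have "G {..b} = G {..a} + G {a<..b}"
      using add[of "{..a}" "{a<..b}"] by fastforce
    then show "G {a<..b} = g b - g a"
      using upto[of a] upto[of b] ab by (simp add: algebra_simps)
  qed
qed



section \<open>Differentiability from the Radon-Nikodym property\<close>

text \<open>
  In a non-separable space a difference of measurable functions need not be measurable. The difference
  with a simple function is, because it is a countable case distinction over differences with constants.
\<close>

lemma borel_measurable_norm_diff_simple:
  fixes h s :: "'w \<Rightarrow> 'b::real_normed_vector"
  assumes h: "h \<in> borel_measurable M" and s: "simple_function M s"
  shows "(\<lambda>x. norm (h x - s x)) \<in> borel_measurable M"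
proof (rule measurable_compose_countable'[where I = "s ` space M" and f = "\<lambda>y x. norm (h x - y)" and g = s])
  fix y :: 'b
  have "(\<lambda>z. norm (z - y)) \<in> borel_measurable borel"
    by (intro borel_measurable_continuous_onI continuous_intros)
  from measurable_compose[OF h this] show "(\<lambda>x. norm (h x - y)) \<in> borel_measurable M" .
next
  show "s \<in> measurable M (count_space (s ` space M))"
    using s by (subst measurable_count_space_eq2) (auto simp: simple_function_def)
  show "countable (s ` space M)"
    using s by (auto simp: simple_function_def countable_finite)
qed

lemma simple_bochner_indicator:
  fixes y :: "'b::real_normed_vector"
  assumes J: "J \<in> sets M" and fin: "emeasure M J < \<infinity>"
  shows "Bochner_Integration.simple_bochner_integrable M (\<lambda>x. indicat_real J x *\<^sub>R y)"
    and "Bochner_Integration.simple_bochner_integral M (\<lambda>x. indicat_real J x *\<^sub>R y) = measure M J *\<^sub>R y"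
proof -
  have ind: "Bochner_Integration.simple_bochner_integrable M (indicat_real J)"
  proof (rule simple_bochner_integrableI_bounded)
    have "(\<integral>\<^sup>+x. norm (indicat_real J x) \<partial>M) = (\<integral>\<^sup>+x. indicator J x \<partial>M)"
      by (intro nn_integral_cong) (auto simp: indicator_def)
    then show "(\<integral>\<^sup>+x. norm (indicat_real J x) \<partial>M) < \<infinity>"
      using J fin by simp
  qed (use J in auto)
  show "Bochner_Integration.simple_bochner_integrable M (\<lambda>x. indicat_real J x *\<^sub>R y)"
    using simple_bochner_integrable_compose2[of "\<lambda>a b. a *\<^sub>R y", OF _ ind ind] by simp
  have "linear (\<lambda>r::real. r *\<^sub>R y)" by (simp add: linear_iff scaleR_add_left)
  from simple_bochner_integral_linear[OF this ind]
  show "Bochner_Integration.simple_bochner_integral M (\<lambda>x. indicat_real J x *\<^sub>R y) = measure M J *\<^sub>R y"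
    using J by (simp add: simple_bochner_integrable_eq_integral[OF ind] Int_absorb2 sets.sets_into_space)
qed

text \<open>
  The triangle inequality for the integral over \<open>J\<close> of \<open>h - y\<close>. It reduces the differentiation of
  the vector measure to that of the integrals of the real functions \<open>norm (h x - y)\<close>.
\<close>

lemma has_Bochner_int_indicator_bound:
  fixes h :: "'w \<Rightarrow> 'b::banach"
  assumes I: "has_Bochner_int M (\<lambda>x. indicat_real J x *\<^sub>R h x) I"
    and h: "h \<in> borel_measurable M"
    and J [measurable]: "J \<in> sets M" and fin: "emeasure M J < \<infinity>"
  shows "ennreal (norm (I - measure M J *\<^sub>R y)) \<le> (\<integral>\<^sup>+x. ennreal (indicat_real J x * norm (h x - y)) \<partial>M)"
proof -
  let ?f = "\<lambda>x. indicat_real J x *\<^sub>R h x" and ?c = "\<lambda>x. indicat_real J x *\<^sub>R y"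
  let ?sint = "Bochner_Integration.simple_bochner_integral M"
  let ?K = "\<integral>\<^sup>+x. ennreal (indicat_real J x * norm (h x - y)) \<partial>M"
  obtain s where f: "?f \<in> borel_measurable M"
    and s: "\<And>i. Bochner_Integration.simple_bochner_integrable M (s i)"
    and s0: "(\<lambda>i. \<integral>\<^sup>+ x. ennreal (norm (?f x - s i x)) \<partial>M) \<longlonglongrightarrow> 0"
    and sI: "(\<lambda>i. ?sint (s i)) \<longlonglongrightarrow> I"
    using I unfolding has_Bochner_int_def by blast
  have simple: "simple_function M (s i)" for i
    using s[of i] by (auto elim: simple_bochner_integrable.cases)
  note c = simple_bochner_indicator[OF J fin, of y]
  have [measurable]: "(\<lambda>x. norm (?f x - s i x)) \<in> borel_measurable M" for i
    by (rule borel_measurable_norm_diff_simple[OF f simple])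
  have [measurable]: "(\<lambda>x. norm (h x - y)) \<in> borel_measurable M"
    by (rule borel_measurable_norm_diff_simple[OF h]) simp
  have bound: "ennreal (norm (?sint (s i) - measure M J *\<^sub>R y))
      \<le> (\<integral>\<^sup>+ x. ennreal (norm (?f x - s i x)) \<partial>M) + ?K" for i
  proof -
    let ?d = "\<lambda>x. s i x - ?c x"
    have d: "Bochner_Integration.simple_bochner_integrable M ?d"
      using simple_bochner_integrable_compose2[of "(-)", OF _ s[of i] c(1)] by simp
    have dn: "Bochner_Integration.simple_bochner_integrable M (\<lambda>x. norm (?d x))"
      using simple_bochner_integrable_compose2[of "\<lambda>a b. norm a", OF _ d d] by simp
    have "ennreal (norm (?sint (s i) - measure M J *\<^sub>R y)) = ennreal (norm (?sint ?d))"
      using simple_bochner_integral_diff[OF s[of i] c(1)] c(2) by simp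
    also have "\<dots> \<le> ennreal (Bochner_Integration.simple_bochner_integral M (\<lambda>x. norm (?d x)))"
      using simple_bochner_integral_norm_bound[OF d] by (rule ennreal_leI)
    also have "\<dots> = (\<integral>\<^sup>+x. norm (?d x) \<partial>M)"
      by (rule simple_bochner_integral_eq_nn_integral[OF dn]) simp
    also have "\<dots> \<le> (\<integral>\<^sup>+x. ennreal (norm (?f x - s i x)) + ennreal (indicat_real J x * norm (h x - y)) \<partial>M)"
    proof (rule nn_integral_mono)
      fix x
      have "norm (?d x) \<le> norm (?f x - s i x) + norm (?f x - ?c x)"
        using norm_triangle_ineq4[of "?f x - ?c x" "?f x - s i x"] by (simp add: add.commute)
      also have "norm (?f x - ?c x) = indicat_real J x * norm (h x - y)"
        by (simp add: scaleR_diff_right[symmetric])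
      finally show "ennreal (norm (?d x)) \<le> ennreal (norm (?f x - s i x)) + ennreal (indicat_real J x * norm (h x - y))"
        by (simp flip: ennreal_plus)
    qed
    also have "\<dots> = (\<integral>\<^sup>+ x. ennreal (norm (?f x - s i x)) \<partial>M) + ?K"
      by (intro nn_integral_add) auto
    finally show ?thesis .
  qed
  show ?thesis
  proof (rule LIMSEQ_le)
    show "(\<lambda>i. ennreal (norm (?sint (s i) - measure M J *\<^sub>R y))) \<longlonglongrightarrow> ennreal (norm (I - measure M J *\<^sub>R y))"
      by (intro tendsto_intros sI)
    have "(\<lambda>i. (\<integral>\<^sup>+ x. ennreal (norm (?f x - s i x)) \<partial>M) + ?K) \<longlonglongrightarrow> 0 + ?K"
      by (intro tendsto_add s0 tendsto_const)
    then show "(\<lambda>i. (\<integral>\<^sup>+ x. ennreal (norm (?f x - s i x)) \<partial>M) + ?K) \<longlonglongrightarrow> ?K" by simp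
  qed (use bound in auto)
qed

text \<open>
  The set \<open>D\<close> collects the values of the approximating simple functions. The infimum of
  \<open>norm (h x - y)\<close> over \<open>y \<in> D\<close> lies below the distance to each approximation, hence has integral 0.
\<close>

lemma Bochner_int_countable_ae_dense:
  fixes h :: "'w \<Rightarrow> 'b::banach"
  assumes I: "has_Bochner_int M h I" and fin: "finite_measure M"
  obtains D where "countable D" "AE x in M. \<forall>e>0. \<exists>y\<in>D. norm (h x - y) < e"
    "\<And>y. y \<in> D \<Longrightarrow> (\<integral>\<^sup>+x. ennreal (norm (h x - y)) \<partial>M) < \<infinity>"
proof -
  obtain s where h: "h \<in> borel_measurable M"
    and s: "\<And>i. Bochner_Integration.simple_bochner_integrable M (s i)"
    and s0: "(\<lambda>i. \<integral>\<^sup>+ x. ennreal (norm (h x - s i x)) \<partial>M) \<longlonglongrightarrow> 0"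
    using I unfolding has_Bochner_int_def by blast
  have simple: "simple_function M (s i)" for i
    using s[of i] by (auto elim: simple_bochner_integrable.cases)
  define D where "D = (\<Union>i. s i ` space M)"
  have fin_range: "finite (s i ` space M)" for i
    using simple[of i] by (simp add: simple_function_def)
  have D: "countable D" unfolding D_def
    by (rule countable_UN) (simp_all add: countable_finite fin_range)
  have meas [measurable]: "(\<lambda>x. norm (h x - y)) \<in> borel_measurable M" for y
    by (rule borel_measurable_norm_diff_simple[OF h]) simp
  have meas' [measurable]: "(\<lambda>x. norm (h x - s i x)) \<in> borel_measurable M" for i
    by (rule borel_measurable_norm_diff_simple[OF h simple])
  define m where "m x = (INF y\<in>D. ennreal (norm (h x - y)))" for x
  have [measurable]: "m \<in> borel_measurable M"
    unfolding m_def by (rule borel_measurable_INF[OF D]) simp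
  have "(\<integral>\<^sup>+x. m x \<partial>M) \<le> (\<integral>\<^sup>+ x. ennreal (norm (h x - s i x)) \<partial>M)" for i
    unfolding m_def by (intro nn_integral_mono INF_lower) (auto simp: D_def)
  then have "(\<integral>\<^sup>+x. m x \<partial>M) \<le> 0"
    by (intro LIMSEQ_le_const[OF s0]) auto
  then have "AE x in M. m x = 0"
    by (simp add: nn_integral_0_iff_AE)
  then have ae: "AE x in M. \<forall>e>0. \<exists>y\<in>D. norm (h x - y) < e"
  proof (rule AE_mp, intro AE_I2 impI allI)
    fix x and e :: real assume "m x = 0" "e > 0"
    then have "(INF y\<in>D. ennreal (norm (h x - y))) < ennreal e"
      unfolding m_def by simp
    then show "\<exists>y\<in>D. norm (h x - y) < e"
      unfolding INF_less_iff by (auto simp: ennreal_less_iff)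
  qed
  show thesis
  proof (rule that[OF D ae])
    fix y
    have "eventually (\<lambda>i. (\<integral>\<^sup>+ x. ennreal (norm (h x - s i x)) \<partial>M) < 1) sequentially"
      by (rule order_tendstoD(2)[OF s0]) simp
    then obtain i where i: "(\<integral>\<^sup>+ x. ennreal (norm (h x - s i x)) \<partial>M) < 1"
      by (auto simp: eventually_sequentially)
    obtain B where B: "\<And>x. x \<in> space M \<Longrightarrow> norm (s i x - y) \<le> B"
      using finite_imp_bounded[OF finite_imageI[OF fin_range[of i], of "\<lambda>z. z - y"]]
      unfolding bounded_iff by auto
    have "(\<integral>\<^sup>+x. ennreal (norm (h x - y)) \<partial>M)
        \<le> (\<integral>\<^sup>+x. ennreal (norm (h x - s i x)) + ennreal B \<partial>M)"
    proof (rule nn_integral_mono)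
      fix x assume x: "x \<in> space M"
      have "norm (h x - y) \<le> norm (h x - s i x) + norm (s i x - y)"
        by (metis dist_norm dist_triangle)
      also have "\<dots> \<le> norm (h x - s i x) + B" using B[OF x] by simp
      finally show "ennreal (norm (h x - y)) \<le> ennreal (norm (h x - s i x)) + ennreal B"
        using order_trans[OF norm_ge_zero B[OF x]]
        by (metis ennreal_leI ennreal_plus norm_ge_zero)
    qed
    also have "\<dots> = (\<integral>\<^sup>+x. ennreal (norm (h x - s i x)) \<partial>M) + ennreal B * emeasure M (space M)"
      by (subst nn_integral_add) auto
    also have "\<dots> < \<infinity>"
      using i finite_measure.emeasure_finite[OF fin, of "space M"]
      by (auto simp: ennreal_mult_less_top less_top[symmetric] ennreal_mult_eq_top_iff)
    finally show "(\<integral>\<^sup>+x. ennreal (norm (h x - y)) \<partial>M) < \<infinity>" .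
  qed
qed

lemma negligible_UN_countable:
  assumes "countable I" "\<And>i. i \<in> I \<Longrightarrow> negligible (A i)"
  shows "negligible (\<Union>i\<in>I. A i)"
  using assms unfolding negligible_iff_null_sets by (rule null_sets_UN')

text \<open>
  Let \<open>h\<close> be the density of the vector measure of \<open>g\<close>. For \<open>y\<close> in a countable set that is dense enough in
  the range of \<open>h\<close>, the real function \<open>norm (h t - y)\<close> has Lebesgue points almost everywhere. At such
  a point \<open>t\<close> the difference quotients of \<open>g\<close> are eventually within about \<open>norm (h t - y)\<close> of \<open>y\<close>, and letting \<open>y\<close>
  tend to \<open>h t\<close> shows that \<open>h t\<close> is the derivative.
\<close>

lemma rnp_lipschitz_ae_differentiable_unit:
  fixes g :: "real \<Rightarrow> 'b::banach"
  assumes rnp: "radon_nikodym_property TYPE('b)" and g: "C-lipschitz_on UNIV g"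
  obtains N where "negligible N"
    "\<And>t. t \<in> {0<..<1} - N \<Longrightarrow> \<exists>y. (g has_vector_derivative y) (at t)"
proof -
  obtain G where G: "vector_measure unit_leb G" "bounded_variation_measure unit_leb G"
      "vanishes_on_null_sets unit_leb G"
    and Gint: "\<And>a b. 0 \<le> a \<Longrightarrow> a \<le> b \<Longrightarrow> b \<le> 1 \<Longrightarrow> G {a<..b} = g b - g a"
    using lipschitz_vector_measure[OF g] by blast
  obtain h where h: "\<And>A. A \<in> sets borel \<Longrightarrow> has_Bochner_int unit_leb (\<lambda>x. indicat_real A x *\<^sub>R h x) (G A)"
    using rnp G unit_leb.finite_measure_axioms unfolding radon_nikodym_property_def
    by (metis sets_unit_leb)
  have hint: "has_Bochner_int unit_leb h (G UNIV)" using h[of UNIV] by simp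
  then have hm: "h \<in> borel_measurable unit_leb" by (simp add: has_Bochner_int_def)
  obtain D where D: "countable D"
    and Dae: "AE x in unit_leb. \<forall>e>0. \<exists>y\<in>D. norm (h x - y) < e"
    and Dint: "\<And>y. y \<in> D \<Longrightarrow> (\<integral>\<^sup>+x. ennreal (norm (h x - y)) \<partial>unit_leb) < \<infinity>"
    using Bochner_int_countable_ae_dense[OF hint unit_leb.finite_measure_axioms] by blast
  have hy: "(\<lambda>x. norm (h x - y)) \<in> borel_measurable borel" for y
    using borel_measurable_norm_diff_simple[OF hm, of "\<lambda>_. y"] by (simp cong: measurable_cong_sets)
  define F where "F y t = indicat_real {0<..1} t * norm (h t - y)" for y t
  have Fm [measurable]: "F y \<in> borel_measurable borel" for y
    unfolding F_def by (intro borel_measurable_times borel_measurable_indicator hy) simp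
  have dens: "(\<integral>\<^sup>+x. ennreal (u x) \<partial>unit_leb) = (\<integral>\<^sup>+x. ennreal (indicat_real {0<..1} x * u x) \<partial>lborel)"
    if [measurable]: "u \<in> borel_measurable borel" for u
    unfolding unit_leb_def
    by (subst nn_integral_density) (auto intro!: nn_integral_cong simp: indicator_def)
  have Fint: "integrable lborel (F y)" if "y \<in> D" for y
  proof (rule integrableI_bounded)
    have "(\<integral>\<^sup>+x. ennreal (norm (F y x)) \<partial>lborel) = (\<integral>\<^sup>+x. ennreal (norm (h x - y)) \<partial>unit_leb)"
      by (subst dens[OF hy]) (simp add: F_def)
    then show "(\<integral>\<^sup>+x. ennreal (norm (F y x)) \<partial>lborel) < \<infinity>" using Dint[OF that] by simp
  qed simp
  have Fhk: "F y integrable_on {a..b}" if "y \<in> D" for y a b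
    using integrable_on_lborel[OF Fint[OF that]] integrable_on_subinterval[of "F y" UNIV a b]
    by (simp add: cbox_interval)
  have key: "norm (g b - g a - (b - a) *\<^sub>R y) \<le> integral {a..b} (F y)"
    if y: "y \<in> D" and ab: "0 \<le> a" "a \<le> b" "b \<le> 1" for y a b
  proof -
    let ?J = "{a<..b}"
    have "ennreal (norm (G ?J - measure unit_leb ?J *\<^sub>R y)) \<le>
        (\<integral>\<^sup>+x. ennreal (indicat_real ?J x * norm (h x - y)) \<partial>unit_leb)"
      by (rule has_Bochner_int_indicator_bound[OF h hm]) (auto simp: less_top[symmetric])
    also have "\<dots> = (\<integral>\<^sup>+x. ennreal (indicat_real {0<..1} x * (indicat_real ?J x * norm (h x - y))) \<partial>lborel)"
      by (intro dens borel_measurable_times borel_measurable_indicator hy) simp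
    also have "\<dots> \<le> (\<integral>\<^sup>+x. ennreal (indicat_real {a..b} x * F y x) \<partial>lborel)"
      by (intro nn_integral_mono) (auto simp: F_def indicator_def)
    also have "\<dots> = ennreal (LINT x:{a..b}|lborel. F y x)"
      using integrable_mult_indicator[OF _ Fint[OF y], of "{a..b}"]
      unfolding set_lebesgue_integral_def real_scaleR_def
      by (subst nn_integral_eq_integral) (auto simp: F_def)
    also have "(LINT x:{a..b}|lborel. F y x) = integral {a..b} (F y)"
      using integrable_mult_indicator[OF _ Fint[OF y], of "{a..b}"]
      by (intro set_borel_integral_eq_integral) (simp add: set_integrable_def)
    finally have "norm (G ?J - measure unit_leb ?J *\<^sub>R y) \<le> integral {a..b} (F y)"
      by (subst (asm) ennreal_le_iff) (auto intro!: Henstock_Kurzweil_Integration.integral_nonneg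
          Fhk[OF y] simp: F_def)
    then show ?thesis
      using ab by (simp add: Gint measure_unit_leb_interval)
  qed
  have "\<exists>N. negligible N \<and> (\<forall>t e. t \<notin> N \<longrightarrow> e > 0 \<longrightarrow> (\<exists>d>0. \<forall>a b. a \<le> t \<and> t \<le> b \<and> b - a < d \<longrightarrow>
          \<bar>integral {a..b} (F y) - (b - a) * F y t\<bar> \<le> e * (b - a)))" if "y \<in> D" for y
    by (rule lebesgue_differentiation_straddle[OF Fhk[OF that]]) blast
  then obtain N where N: "\<And>y. y \<in> D \<Longrightarrow> negligible (N y)"
    and ND: "\<And>y t e. y \<in> D \<Longrightarrow> t \<notin> N y \<Longrightarrow> e > 0 \<Longrightarrow> (\<exists>d>0. \<forall>a b. a \<le> t \<and> t \<le> b \<and> b - a < d \<longrightarrow>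
          \<bar>integral {a..b} (F y) - (b - a) * F y t\<bar> \<le> e * (b - a))"
    by metis
  have "AE x in lborel. 0 < (indicator {0<..1} x :: ennreal) \<longrightarrow> (\<forall>e>0. \<exists>y\<in>D. norm (h x - y) < e)"
    using Dae unfolding unit_leb_def by (subst (asm) AE_density) auto
  then obtain N0 where N0: "N0 \<in> null_sets lborel"
    and N0sub: "{x \<in> space lborel. \<not> (0 < (indicator {0<..1} x :: ennreal) \<longrightarrow>
      (\<forall>e>0. \<exists>y\<in>D. norm (h x - y) < e))} \<subseteq> N0"
    unfolding eventually_ae_filter by blast
  have N0': "\<exists>y\<in>D. norm (h x - y) < e" if "x \<notin> N0" "x \<in> {0<..1}" "e > 0" for x e
  proof -
    have "0 < (indicator {0<..1} x :: ennreal)" using that by (simp add: indicator_def)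
    then show ?thesis using N0sub that(1,3) by auto
  qed
  have "negligible N0"
    using N0 null_sets_completionI negligible_iff_null_sets by blast
  moreover have "negligible (\<Union>y\<in>D. N y)"
    using N D by (intro negligible_UN_countable) auto
  ultimately have neg: "negligible (N0 \<union> (\<Union>y\<in>D. N y))" by (simp add: negligible_Un)
  show thesis
  proof (rule that[OF neg])
    fix t assume t: "t \<in> {0<..<1} - (N0 \<union> (\<Union>y\<in>D. N y))"
    have appr: "\<exists>y\<in>D. norm (h t - y) < e" if "e > 0" for e
      using t that by (intro N0') auto
    have straddle: "\<exists>d>0. \<forall>a b. a \<le> t \<and> t \<le> b \<and> b - a < d \<longrightarrow>
        norm (g b - g a - (b - a) *\<^sub>R h t) \<le> e * (b - a)" if e: "e > 0" for e
    proof -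
      obtain y where y: "y \<in> D" "norm (h t - y) < e / 3" using appr[of "e / 3"] e by auto
      have Ft: "F y t \<le> e / 3" using t y by (simp add: F_def)
      obtain d where d: "d > 0" and dd: "\<And>a b. a \<le> t \<Longrightarrow> t \<le> b \<Longrightarrow> b - a < d \<Longrightarrow>
          \<bar>integral {a..b} (F y) - (b - a) * F y t\<bar> \<le> e / 3 * (b - a)"
        using ND[OF y(1), of t "e / 3"] t y(1) e by auto
      show ?thesis
      proof (intro exI[of _ "min d (min t (1 - t))"] conjI allI impI)
        show "min d (min t (1 - t)) > 0" using d t by auto
        fix a b assume ab: "a \<le> t \<and> t \<le> b \<and> b - a < min d (min t (1 - t))"
        have "g b - g a - (b - a) *\<^sub>R h t = (g b - g a - (b - a) *\<^sub>R y) - (b - a) *\<^sub>R (h t - y)"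
          by (simp add: algebra_simps)
        then have "norm (g b - g a - (b - a) *\<^sub>R h t)
            \<le> norm (g b - g a - (b - a) *\<^sub>R y) + norm ((b - a) *\<^sub>R (h t - y))"
          by (simp only: norm_triangle_ineq4)
        also have "norm ((b - a) *\<^sub>R (h t - y)) \<le> (b - a) * (e / 3)"
          using ab mult_left_mono[of "norm (h t - y)" "e / 3" "b - a"] y(2) by simp
        also have "norm (g b - g a - (b - a) *\<^sub>R y) \<le> integral {a..b} (F y)"
          using ab t by (intro key y) auto
        also have "integral {a..b} (F y) \<le> (b - a) * F y t + e / 3 * (b - a)"
          using dd[of a b] ab by linarith
        also have "(b - a) * F y t \<le> (b - a) * (e / 3)"
          using ab Ft by (intro mult_left_mono) auto
        finally show "norm (g b - g a - (b - a) *\<^sub>R h t) \<le> e * (b - a)"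
          by (simp add: field_simps)
      qed
    qed
    have "(g has_vector_derivative h t) (at t)"
      unfolding has_vector_derivative_def has_derivative_at_alt
    proof (intro conjI allI impI bounded_linear_scaleR_left)
      fix e :: real assume "e > 0"
      from straddle[OF this] obtain d where d: "d > 0"
        and "\<forall>a b. a \<le> t \<and> t \<le> b \<and> b - a < d \<longrightarrow> norm (g b - g a - (b - a) *\<^sub>R h t) \<le> e * (b - a)"
        by (elim exE conjE)
      then have dd: "norm (g b - g a - (b - a) *\<^sub>R h t) \<le> e * (b - a)"
        if "a \<le> t" "t \<le> b" "b - a < d" for a b using that by blast
      show "\<exists>d>0. \<forall>y. norm (y - t) < d \<longrightarrow> norm (g y - g t - (y - t) *\<^sub>R h t) \<le> e * norm (y - t)"
      proof (intro exI[of _ d] conjI allI impI d)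
        fix y assume y: "norm (y - t) < d"
        show "norm (g y - g t - (y - t) *\<^sub>R h t) \<le> e * norm (y - t)"
        proof (cases "t \<le> y")
          case True
          then show ?thesis using dd[of t y] y by simp
        next
          case False
          have "g y - g t - (y - t) *\<^sub>R h t = - (g t - g y - (t - y) *\<^sub>R h t)"
            by (simp add: algebra_simps)
          then have "norm (g y - g t - (y - t) *\<^sub>R h t) = norm (g t - g y - (t - y) *\<^sub>R h t)"
            by (simp only: norm_minus_cancel)
          then show ?thesis using dd[of y t] y False by auto
        qed
      qed
    qed
    then show "\<exists>y. (g has_vector_derivative y) (at t)" ..
  qed
qed

proposition rnp_lipschitz_ae_differentiable:
  fixes g :: "real \<Rightarrow> 'b::banach"
  assumes rnp: "radon_nikodym_property TYPE('b)" and g: "C-lipschitz_on UNIV g"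
  shows "negligible {t. \<nexists>y. (g has_vector_derivative y) (at t)}"
proof -
  have "\<exists>N. negligible N \<and> (\<forall>t\<in>{0<..<1} - N. \<exists>y. ((\<lambda>t. g (of_int n + t)) has_vector_derivative y) (at t))"
    for n :: int
  proof -
    have "C-lipschitz_on UNIV (\<lambda>t. g (of_int n + t))"
      using g by (auto simp: lipschitz_on_def dist_norm) (metis add_diff_cancel_left)
    then obtain N where "negligible N"
      "\<And>t. t \<in> {0<..<1} - N \<Longrightarrow> \<exists>y. ((\<lambda>t. g (of_int n + t)) has_vector_derivative y) (at t)"
      using rnp_lipschitz_ae_differentiable_unit[OF rnp, of C "\<lambda>t. g (of_int n + t)"] by metis
    then show ?thesis by blast
  qed
  then obtain N where N: "\<And>n :: int. negligible (N n)"
    and ND: "\<And>n t. t \<in> {0<..<1} - N n \<Longrightarrow> \<exists>y. ((\<lambda>t. g (of_int n + t)) has_vector_derivative y) (at t)"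
    by metis
  have "negligible (\<Union>n. insert (of_int n) ((+) (of_int n) ` N n))"
    using N by (intro negligible_UN_countable) (auto intro: negligible_translation)
  then show ?thesis
  proof (rule negligible_subset, safe)
    fix t assume no: "\<nexists>y. (g has_vector_derivative y) (at t)" 
    show "t \<in> (\<Union>n. insert (of_int n) ((+) (of_int n) ` N n))"
    proof (rule ccontr)
      assume t: "\<not> ?thesis"
      define n where "n = \<lfloor>t\<rfloor>"
      have "t \<noteq> of_int n" using t by auto
      then have u: "t - of_int n \<in> {0<..<1}" unfolding n_def
        by (auto, linarith+)
      have "t - of_int n \<notin> N n"
      proof
        assume "t - of_int n \<in> N n"
        then have "of_int n + (t - of_int n) \<in> (+) (of_int n) ` N n" by (rule imageI)
        then show False using t by auto
      qed
      then obtain y where y: "((\<lambda>t. g (of_int n + t)) has_vector_derivative y) (at (t - of_int n))"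
        using ND[of "t - of_int n" n] u by auto
      have "((\<lambda>s. s - of_int n) has_vector_derivative 1) (at t)"
        by (auto intro!: derivative_eq_intros)
      from vector_diff_chain_at[OF this y] have "(g has_vector_derivative y) (at t)"
        by (simp add: o_def)
      then show False using no by blast
    qed
  qed
qed

section \<open>Lipschitz extension from a closed set of reals\<close>

text \<open>
  Interpolate linearly on the bounded gaps of \<open>T\<close> and extend by constants on the unbounded ones. Two points in
  the same gap are compared directly; otherwise the comparison passes through the points of \<open>T\<close>
  that delimit their gaps.
\<close>

lemma lipschitz_extend_real:
  fixes g :: "real \<Rightarrow> 'b::real_normed_vector"
  assumes T: "closed T" and g: "M-lipschitz_on T g"
  obtains G where "M-lipschitz_on UNIV G" "\<And>t. t \<in> T \<Longrightarrow> G t = g t"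
proof (cases "T = {}")
  case True
  have "M-lipschitz_on UNIV (\<lambda>_::real. 0::'b)"
    using lipschitz_on_nonneg[OF g] by (auto simp: lipschitz_on_def)
  then show thesis using that True by blast
next
  case False
  have M: "M \<ge> 0" using g by (rule lipschitz_on_nonneg)
  define lo where "lo t = Sup (T \<inter> {..t})" for t
  define hi where "hi t = Inf (T \<inter> {t..})" for t
  define a where "a t = (if T \<inter> {..t} = {} then hi t else lo t)" for t
  define b where "b t = (if T \<inter> {t..} = {} then lo t else hi t)" for t
  have lo: "lo t \<in> T \<inter> {..t}" if "T \<inter> {..t} \<noteq> {}" for t
    unfolding lo_def using that T by (intro closed_contains_Sup) auto
  have hi: "hi t \<in> T \<inter> {t..}" if "T \<inter> {t..} \<noteq> {}" for t
    unfolding hi_def using that T by (intro closed_contains_Inf) auto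
  have some: "T \<inter> {..t} \<noteq> {} \<or> T \<inter> {t..} \<noteq> {}" for t using False by fastforce
  have aT: "a t \<in> T" and bT: "b t \<in> T" for t
    using lo[of t] hi[of t] some[of t] by (auto simp: a_def b_def)
  have between: "a t \<le> t \<and> t \<le> b t" if "a t \<noteq> b t" for t
    using that lo[of t] hi[of t] some[of t] by (auto simp: a_def b_def split: if_splits)
  \<comment> \<open>One formula covers all cases: if \<open>t \<in> T\<close> or if \<open>t\<close> lies in an unbounded gap, the second summand vanishes.\<close>
  define G where "G t = g (a t) + ((t - a t) / (b t - a t)) *\<^sub>R (g (b t) - g (a t))" for t
  have left: "norm (G t - g (a t)) \<le> M * (t - a t)" if "a t \<le> t" for t
  proof (cases "a t = b t")
    case True then show ?thesis using M that by (simp add: G_def)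
  next
    case False
    note bt = between[OF False]
    have "norm (G t - g (a t)) = (t - a t) / (b t - a t) * norm (g (b t) - g (a t))"
      using bt by (simp add: G_def)
    also have "\<dots> \<le> (t - a t) / (b t - a t) * (M * (b t - a t))"
      using bt lipschitz_on_normD[OF g bT[of t] aT[of t]] by (intro mult_left_mono) auto
    also have "\<dots> = M * (t - a t)" using False by simp
    finally show ?thesis .
  qed
  have right: "norm (g (b t) - G t) \<le> M * (b t - t)" if "t \<le> b t" for t
  proof (cases "a t = b t")
    case True then show ?thesis using M that by (simp add: G_def)
  next
    case False
    note bt = between[OF False]
    have "1 - (t - a t) / (b t - a t) = (b t - t) / (b t - a t)"
      using False by (simp add: field_simps)
    moreover have "g (b t) - G t = (1 - (t - a t) / (b t - a t)) *\<^sub>R (g (b t) - g (a t))"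
      by (simp add: G_def scaleR_diff_left)
    ultimately have "norm (g (b t) - G t) = (b t - t) / (b t - a t) * norm (g (b t) - g (a t))"
      using bt by simp
    also have "\<dots> \<le> (b t - t) / (b t - a t) * (M * (b t - a t))"
      using bt lipschitz_on_normD[OF g bT[of t] aT[of t]] by (intro mult_left_mono) auto
    also have "\<dots> = M * (b t - t)" using False by simp
    finally show ?thesis .
  qed
  have Lip: "norm (G t - G s) \<le> M * (t - s)" if "s < t" for s t
  proof (cases "T \<inter> {s..t} = {}")
    case True
    then have eq: "T \<inter> {..s} = T \<inter> {..t}" "T \<inter> {s..} = T \<inter> {t..}"
      using that by (auto simp: disjoint_iff) 
    then have ab: "a s = a t" "b s = b t" by (auto simp: a_def b_def lo_def hi_def)
    show ?thesis
    proof (cases "a t = b t")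
      case True then show ?thesis using M that ab by (simp add: G_def)
    next
      case False
      note bt = between[OF False]
      have "G t - G s = ((t - s) / (b t - a t)) *\<^sub>R (g (b t) - g (a t))"
        by (simp add: G_def ab scaleR_diff_left[symmetric] diff_divide_distrib[symmetric])
      then have "norm (G t - G s) = (t - s) / (b t - a t) * norm (g (b t) - g (a t))"
        using bt that by simp
      also have "\<dots> \<le> (t - s) / (b t - a t) * (M * (b t - a t))"
        using bt that lipschitz_on_normD[OF g bT[of t] aT[of t]] by (intro mult_left_mono) auto
      also have "\<dots> = M * (t - s)" using False by simp
      finally show ?thesis .
    qed
  next
    case False
    then obtain p where p: "p \<in> T" "s \<le> p" "p \<le> t" by auto
    have ne: "T \<inter> {s..} \<noteq> {}" "T \<inter> {..t} \<noteq> {}" using p by auto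
    have bs: "b s = hi s" and at: "a t = lo t" using ne by (auto simp: a_def b_def)
    have "hi s \<le> p" unfolding hi_def using p by (intro cInf_lower) (auto intro: bdd_belowI[of _ s])
    moreover have "p \<le> lo t" unfolding lo_def using p by (intro cSup_upper) (auto intro: bdd_aboveI[of _ t])
    ultimately have ord: "s \<le> b s" "b s \<le> a t" "a t \<le> t"
      using lo[OF ne(2)] hi[OF ne(1)] by (auto simp: bs at)
    have "norm (G t - G s) \<le> norm (G t - g (a t)) + norm (g (a t) - g (b s)) + norm (g (b s) - G s)"
      using norm_triangle_ineq[of "(G t - g (a t)) + (g (a t) - g (b s))" "g (b s) - G s"]
        norm_triangle_ineq[of "G t - g (a t)" "g (a t) - g (b s)"] by simp
    also have "\<dots> \<le> M * (t - a t) + M * (a t - b s) + M * (b s - s)"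
      using left[OF ord(3)] right[OF ord(1)] lipschitz_on_normD[OF g aT[of t] bT[of s]] ord by simp
    also have "\<dots> = M * (t - s)" by (simp add: algebra_simps)
    finally show ?thesis .
  qed
  show thesis
  proof
    show "M-lipschitz_on UNIV G"
    proof (rule lipschitz_onI[OF _ M])
      fix s t :: real
      consider "s < t" | "s = t" | "t < s" by linarith
      then show "dist (G s) (G t) \<le> M * dist s t"
        by cases (use Lip[of s t] Lip[of t s] in \<open>auto simp: dist_norm norm_minus_commute abs_if\<close>)
    qed
    fix t assume t: "t \<in> T"
    then have ne: "T \<inter> {..t} \<noteq> {}" by auto
    have "t \<le> lo t" unfolding lo_def using t by (intro cSup_upper) (auto intro: bdd_aboveI[of _ t])
    then have "a t = t" using lo[OF ne] ne by (auto simp: a_def)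
    then show "G t = g t" by (simp add: G_def)
  qed
qed

section \<open>Directions tangent to the graph\<close>

text \<open>
  Up to scale \<open>r\<close>, the line through \<open>(x, f x)\<close> with direction \<open>(u, y)\<close> stays close to the graph of
  \<open>f\<close> over \<open>C\<close>. Stating this by the distance to the graph, rather than by the existence of a nearby point
  of it, makes the set of such \<open>x\<close> closed relative to any closed set on which \<open>f\<close> is continuous.
\<close>

definition nearly_tangent ::
    "('a::real_normed_vector \<Rightarrow> 'b::real_normed_vector) \<Rightarrow> 'a set \<Rightarrow> 'a \<Rightarrow> 'b \<Rightarrow> real \<Rightarrow> real \<Rightarrow> 'a \<Rightarrow> bool" where
  "nearly_tangent f C u y \<eta> r x \<longleftrightarrow>
     (\<forall>s. \<bar>s\<bar> < r \<longrightarrow> infdist (x + s *\<^sub>R u, f x + s *\<^sub>R y) ((\<lambda>z. (z, f z)) ` C) \<le> \<eta> * \<bar>s\<bar>)"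

lemma infdist_lessD:
  assumes "infdist p S < e" "S \<noteq> {}"
  obtains q where "q \<in> S" "dist p q < e"
  using assms by (auto simp: infdist_notempty cINF_less_iff)

lemma dist_Pair_le: "dist (a, b) (c, d) \<le> norm (a - c) + norm (b - d)"
  for a c :: "'a::real_normed_vector" and b d :: "'b::real_normed_vector"
  using norm_Pair_le[of "a - c" "b - d"] by (simp add: dist_norm)

lemma nearly_tangent_witness:
  assumes nt: "nearly_tangent f C u y \<eta> r x" and x: "x \<in> C" and \<eta>: "\<eta> > 0" and s: "s \<noteq> 0" "\<bar>s\<bar> < r"
  obtains z where "z \<in> C" "norm (z - (x + s *\<^sub>R u)) \<le> 2 * \<eta> * \<bar>s\<bar>"
    "norm (f z - (f x + s *\<^sub>R y)) \<le> 2 * \<eta> * \<bar>s\<bar>"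
proof -
  have "infdist (x + s *\<^sub>R u, f x + s *\<^sub>R y) ((\<lambda>z. (z, f z)) ` C) \<le> \<eta> * \<bar>s\<bar>"
    using nt s by (simp add: nearly_tangent_def)
  also have "\<dots> < 2 * \<eta> * \<bar>s\<bar>" using \<eta> s by simp
  finally obtain z where z: "z \<in> C" "dist (x + s *\<^sub>R u, f x + s *\<^sub>R y) (z, f z) < 2 * \<eta> * \<bar>s\<bar>"
    using x by (elim infdist_lessD) auto
  show thesis
  proof (rule that[OF z(1)])
    show "norm (z - (x + s *\<^sub>R u)) \<le> 2 * \<eta> * \<bar>s\<bar>"
      using dist_fst_le[of "(x + s *\<^sub>R u, f x + s *\<^sub>R y)" "(z, f z)"] z(2)
      by (simp add: dist_norm norm_minus_commute)
    show "norm (f z - (f x + s *\<^sub>R y)) \<le> 2 * \<eta> * \<bar>s\<bar>"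
      using dist_snd_le[of "(x + s *\<^sub>R u, f x + s *\<^sub>R y)" "(z, f z)"] z(2)
      by (simp add: dist_norm norm_minus_commute)
  qed
qed

lemma nearly_tangent_mono:
  assumes "nearly_tangent f C u y \<eta> r x" "\<eta> \<le> \<eta>'" "r' \<le> r"
  shows "nearly_tangent f C u y \<eta>' r' x"
  using assms unfolding nearly_tangent_def by (meson abs_ge_zero less_le_trans mult_right_mono order_trans)

lemma nearly_tangent_superset:
  assumes "nearly_tangent f C u y \<eta> r x" "C \<subseteq> C'" "C \<noteq> {}"
  shows "nearly_tangent f C' u y \<eta> r x"
  using assms infdist_mono[of "(\<lambda>z. (z, f z)) ` C" "(\<lambda>z. (z, f z)) ` C'"]
  unfolding nearly_tangent_def by (meson image_is_empty image_mono order_trans)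

lemma nearly_tangent_perturb:
  assumes nt: "nearly_tangent f C u y \<eta> r x" and d: "norm (u' - u) + norm (y' - y) \<le> \<delta>"
  shows "nearly_tangent f C u' y' (\<eta> + \<delta>) r x"
  unfolding nearly_tangent_def
proof (intro allI impI)
  fix s :: real assume s: "\<bar>s\<bar> < r"
  let ?\<Gamma> = "(\<lambda>z. (z, f z)) ` C"
  have "infdist (x + s *\<^sub>R u', f x + s *\<^sub>R y') ?\<Gamma> \<le> infdist (x + s *\<^sub>R u, f x + s *\<^sub>R y) ?\<Gamma>
     + dist (x + s *\<^sub>R u', f x + s *\<^sub>R y') (x + s *\<^sub>R u, f x + s *\<^sub>R y)"
    by (rule infdist_triangle)
  also have "dist (x + s *\<^sub>R u', f x + s *\<^sub>R y') (x + s *\<^sub>R u, f x + s *\<^sub>R y)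
      \<le> norm (s *\<^sub>R (u' - u)) + norm (s *\<^sub>R (y' - y))"
    using dist_Pair_le[of "x + s *\<^sub>R u'" "f x + s *\<^sub>R y'" "x + s *\<^sub>R u" "f x + s *\<^sub>R y"]
    by (simp add: scaleR_diff_right)
  also have "\<dots> = \<bar>s\<bar> * (norm (u' - u) + norm (y' - y))" by (simp add: distrib_left)
  also have "\<dots> \<le> \<bar>s\<bar> * \<delta>" using d by (intro mult_left_mono) auto
  also have "infdist (x + s *\<^sub>R u, f x + s *\<^sub>R y) ?\<Gamma> \<le> \<eta> * \<bar>s\<bar>"
    using nt s by (simp add: nearly_tangent_def)
  finally show "infdist (x + s *\<^sub>R u', f x + s *\<^sub>R y') ?\<Gamma> \<le> (\<eta> + \<delta>) * \<bar>s\<bar>"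
    by (simp add: algebra_simps)
qed

lemma nearly_tangent_scale:
  assumes nt: "nearly_tangent f C u y \<eta> r x" and c: "c \<noteq> 0"
  shows "nearly_tangent f C (c *\<^sub>R u) (c *\<^sub>R y) (\<eta> * \<bar>c\<bar>) (r / \<bar>c\<bar>) x"
  unfolding nearly_tangent_def
proof (intro allI impI)
  fix s :: real assume "\<bar>s\<bar> < r / \<bar>c\<bar>"
  then have "\<bar>s * c\<bar> < r" using c by (simp add: abs_mult pos_less_divide_eq)
  then have "infdist (x + (s * c) *\<^sub>R u, f x + (s * c) *\<^sub>R y) ((\<lambda>z. (z, f z)) ` C) \<le> \<eta> * \<bar>s * c\<bar>"
    using nt unfolding nearly_tangent_def by blast
  then show "infdist (x + s *\<^sub>R c *\<^sub>R u, f x + s *\<^sub>R c *\<^sub>R y) ((\<lambda>z. (z, f z)) ` C) \<le> \<eta> * \<bar>c\<bar> * \<bar>s\<bar>"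
    by (simp add: abs_mult mult_ac)
qed

lemma nearly_tangent_zero: "x \<in> C \<Longrightarrow> \<eta> \<ge> 0 \<Longrightarrow> nearly_tangent f C 0 0 \<eta> r x"
  by (simp add: nearly_tangent_def)

text \<open>
  Two steps along the graph: from \<open>(x, f x)\<close> follow \<open>s (w, y')\<close> to a point over some \<open>z \<in> C1\<close>, then
  follow \<open>s (u, y)\<close> from there. The scale \<open>r\<close> has to be uniform over \<open>C1\<close>, since \<open>z\<close> depends on \<open>s\<close>.
\<close>

lemma nearly_tangent_add:
  assumes C1: "C1 \<subseteq> C" "\<And>z. z \<in> C1 \<Longrightarrow> nearly_tangent f C u y \<eta> r z"
    and x: "x \<in> C1" and nt: "nearly_tangent f C1 w y' \<eta>' r x"
  shows "nearly_tangent f C (u + w) (y + y') (\<eta> + \<eta>') r x"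
  unfolding nearly_tangent_def
proof (intro allI impI)
  fix s :: real assume s: "\<bar>s\<bar> < r"
  let ?\<Gamma> = "\<lambda>C. (\<lambda>z. (z, f z)) ` C"
  show "infdist (x + s *\<^sub>R (u + w), f x + s *\<^sub>R (y + y')) (?\<Gamma> C) \<le> (\<eta> + \<eta>') * \<bar>s\<bar>"
  proof (rule field_le_epsilon)
    fix e :: real assume e: "e > 0"
    have "infdist (x + s *\<^sub>R w, f x + s *\<^sub>R y') (?\<Gamma> C1) \<le> \<eta>' * \<bar>s\<bar>"
      using nt s by (simp add: nearly_tangent_def)
    also have "\<dots> < \<eta>' * \<bar>s\<bar> + e" using e by simp
    finally obtain z where z: "z \<in> C1" "dist (x + s *\<^sub>R w, f x + s *\<^sub>R y') (z, f z) < \<eta>' * \<bar>s\<bar> + e"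
      using x by (elim infdist_lessD) auto
    have shift: "(x + s *\<^sub>R (u + w), f x + s *\<^sub>R (y + y')) - (z + s *\<^sub>R u, f z + s *\<^sub>R y)
        = (x + s *\<^sub>R w, f x + s *\<^sub>R y') - (z, f z)" by (simp add: algebra_simps)
    have "infdist (x + s *\<^sub>R (u + w), f x + s *\<^sub>R (y + y')) (?\<Gamma> C)
        \<le> infdist (z + s *\<^sub>R u, f z + s *\<^sub>R y) (?\<Gamma> C)
          + dist (x + s *\<^sub>R (u + w), f x + s *\<^sub>R (y + y')) (z + s *\<^sub>R u, f z + s *\<^sub>R y)"
      by (rule infdist_triangle)
    also have "dist (x + s *\<^sub>R (u + w), f x + s *\<^sub>R (y + y')) (z + s *\<^sub>R u, f z + s *\<^sub>R y)
        = dist (x + s *\<^sub>R w, f x + s *\<^sub>R y') (z, f z)"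
      unfolding dist_norm shift ..
    also have "infdist (z + s *\<^sub>R u, f z + s *\<^sub>R y) (?\<Gamma> C) \<le> \<eta> * \<bar>s\<bar>"
      using C1(2)[OF z(1)] s by (simp add: nearly_tangent_def)
    finally show "infdist (x + s *\<^sub>R (u + w), f x + s *\<^sub>R (y + y')) (?\<Gamma> C) \<le> (\<eta> + \<eta>') * \<bar>s\<bar> + e"
      using z(2) by (simp add: algebra_simps)
  qed
qed

lemma closed_nearly_tangent:
  assumes A: "closed A" and f: "continuous_on A f"
  shows "closed {x \<in> A. nearly_tangent f C u y \<eta> r x}"
proof -
  have "closed {x \<in> A. infdist (x + s *\<^sub>R u, f x + s *\<^sub>R y) ((\<lambda>z. (z, f z)) ` C) \<le> \<eta> * \<bar>s\<bar>}" for s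
    by (intro continuous_on_closed_Collect_le continuous_intros A f)
  then have "closed (A \<inter> (\<Inter>s\<in>{s. \<bar>s\<bar> < r}.
      {x \<in> A. infdist (x + s *\<^sub>R u, f x + s *\<^sub>R y) ((\<lambda>z. (z, f z)) ` C) \<le> \<eta> * \<bar>s\<bar>}))"
    by (intro closed_Int closed_INT A) auto
  also have "(A \<inter> (\<Inter>s\<in>{s. \<bar>s\<bar> < r}.
      {x \<in> A. infdist (x + s *\<^sub>R u, f x + s *\<^sub>R y) ((\<lambda>z. (z, f z)) ` C) \<le> \<eta> * \<bar>s\<bar>}))
      = {x \<in> A. nearly_tangent f C u y \<eta> r x}"
    by (auto simp: nearly_tangent_def)
  finally show ?thesis .
qed

text \<open>
  Here \<open>\<phi>\<close> is a test curve for \<open>Atilde_eps v (\<eta>/8)\<close>. The derivative of \<open>f \<circ> \<phi>\<close> serves as the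
  slope \<open>y\<close>, although \<open>\<phi>\<close> itself need not be differentiable: \<open>\<phi> t'\<close> differs from \<open>\<phi> t + (t' - t) v\<close> by at
  most \<open>\<eta>/8 * \<bar>t' - t\<bar>\<close>, and the definition of \<open>nearly_tangent\<close> tolerates such an error.
\<close>

lemma nearly_tangent_along_curve:
  fixes f :: "'a::real_normed_vector \<Rightarrow> 'b::banach"
  assumes rnp: "radon_nikodym_property TYPE('b)"
    and A: "closed A" and f: "L-lipschitz_on A f"
    and C: "C \<subseteq> A" "C \<in> sets borel" and \<eta>: "\<eta> > 0"
    and \<phi>: "(\<eta>/8)-lipschitz_on UNIV (\<lambda>t. \<phi> t - t *\<^sub>R v)"
  shows "negligible {t. \<phi> t \<in> C \<and> \<not> (\<exists>y r. r > 0 \<and> nearly_tangent f C v y \<eta> r (\<phi> t))}"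
proof -
  have "(norm v)-lipschitz_on UNIV (\<lambda>t. t *\<^sub>R v)"
    by (auto simp: lipschitz_on_def dist_norm scaleR_diff_left[symmetric])
  from lipschitz_on_add[OF \<phi> this]
  have \<phi>L: "(\<eta>/8 + norm v)-lipschitz_on UNIV \<phi>" by simp
  then have cont: "continuous_on UNIV \<phi>" by (rule lipschitz_on_continuous_on)
  have "closed (\<phi> -` A)" using A cont by (simp add: closed_vimage)
  moreover have "(L * (\<eta>/8 + norm v))-lipschitz_on (\<phi> -` A) (\<lambda>t. f (\<phi> t))"
    by (rule lipschitz_on_compose2[OF lipschitz_on_subset[OF \<phi>L] lipschitz_on_subset[OF f]]) auto
  ultimately obtain G where GL: "(L * (\<eta>/8 + norm v))-lipschitz_on UNIV G"
    and G: "\<And>t. t \<in> \<phi> -` A \<Longrightarrow> G t = f (\<phi> t)"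
    using lipschitz_extend_real by blast
  define T where "T = \<phi> -` C"
  have GT: "G t = f (\<phi> t)" if "t \<in> T" for t using G[of t] that C(1) by (auto simp: T_def)
  have "T \<in> sets borel"
    unfolding T_def using measurable_sets_borel[OF borel_measurable_continuous_onI[OF cont] C(2)] by simp
  then have "T \<in> sets lebesgue" by simp
  then obtain N where N: "negligible N"
    and ND: "\<And>t \<delta>. t \<in> T - N \<Longrightarrow> \<delta> > 0 \<Longrightarrow>
          \<exists>d>0. \<forall>s. \<bar>s\<bar> < d \<longrightarrow> (\<exists>t'\<in>T. \<bar>t' - (t + s)\<bar> \<le> \<delta> * \<bar>s\<bar>)"
    using ae_density_approach by blast
  have "negligible (N \<union> {t. \<nexists>y. (G has_vector_derivative y) (at t)})"
    using N rnp_lipschitz_ae_differentiable[OF rnp GL] by (simp add: negligible_Un)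
  then show ?thesis
  proof (rule negligible_subset, safe)
    fix t y assume t: "\<phi> t \<in> C" and tN: "t \<notin> N" and y: "(G has_vector_derivative y) (at t)"
      and no: "\<not> (\<exists>y r. r > 0 \<and> nearly_tangent f C v y \<eta> r (\<phi> t))"
    have tT: "t \<in> T" using t by (simp add: T_def)
    \<comment> \<open>Replacing \<open>t + s\<close> by a point \<open>t'\<close> of \<open>T\<close> costs \<open>\<delta> * \<bar>s\<bar> * (norm v + norm y)\<close>; \<open>\<delta>\<close> makes this at most \<open>\<eta>/2 * \<bar>s\<bar>\<close>.\<close>
    define K where "K = 1 + norm v + norm y"
    have K: "K > 0" by (simp add: K_def add_pos_nonneg)
    define \<delta> where "\<delta> = min 1 (\<eta> / (2 * K))"
    have \<delta>: "\<delta> > 0" "\<delta> \<le> 1" using \<eta> K by (auto simp: \<delta>_def)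
    have "\<delta> \<le> \<eta> / (2 * K)" by (simp add: \<delta>_def)
    then have "\<delta> * K \<le> \<eta> / 2" using K by (simp add: field_simps)
    then have \<delta>K: "\<delta> * (norm v + norm y) \<le> \<eta> / 2" using \<delta>(1) by (simp add: K_def algebra_simps)
    obtain d1 where d1: "d1 > 0" and dens: "\<And>s. \<bar>s\<bar> < d1 \<Longrightarrow> \<exists>t'\<in>T. \<bar>t' - (t + s)\<bar> \<le> \<delta> * \<bar>s\<bar>"
      using ND[of t \<delta>] tT tN \<delta> by auto
    obtain d2 where d2: "d2 > 0" and der: "\<And>t'. \<bar>t' - t\<bar> < d2 \<Longrightarrow>
        norm (G t' - G t - (t' - t) *\<^sub>R y) \<le> \<eta>/8 * \<bar>t' - t\<bar>"
    proof -
      have "\<eta> / 8 > 0" using \<eta> by simp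
      with y have "\<exists>d>0. \<forall>t'. norm (t' - t) < d \<longrightarrow>
          norm (G t' - G t - (t' - t) *\<^sub>R y) \<le> \<eta>/8 * norm (t' - t)"
        unfolding has_vector_derivative_def has_derivative_at_alt by blast
      then show thesis using that by (metis real_norm_def)
    qed
    have "nearly_tangent f C v y \<eta> (min d1 (d2/2)) (\<phi> t)"
      unfolding nearly_tangent_def
    proof (intro allI impI)
      fix s :: real assume s: "\<bar>s\<bar> < min d1 (d2/2)"
      obtain t' where t': "t' \<in> T" "\<bar>t' - (t + s)\<bar> \<le> \<delta> * \<bar>s\<bar>" using dens[of s] s by auto
      define h where "h = t' - t"
      have hs: "\<bar>h - s\<bar> \<le> \<delta> * \<bar>s\<bar>" using t'(2) by (simp add: h_def algebra_simps)
      have "\<delta> * \<bar>s\<bar> \<le> 1 * \<bar>s\<bar>" using \<delta> by (intro mult_right_mono) auto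
      then have h: "\<bar>h\<bar> \<le> 2 * \<bar>s\<bar>" using hs by linarith
      have "norm (\<phi> t + s *\<^sub>R v - \<phi> t') \<le> \<eta>/8 * \<bar>h\<bar> + \<bar>h - s\<bar> * norm v"
      proof -
        have "\<phi> t + s *\<^sub>R v - \<phi> t' = - (((\<phi> t' - t' *\<^sub>R v) - (\<phi> t - t *\<^sub>R v)) + (h - s) *\<^sub>R v)"
          by (simp add: h_def algebra_simps)
        then have "norm (\<phi> t + s *\<^sub>R v - \<phi> t')
            = norm (((\<phi> t' - t' *\<^sub>R v) - (\<phi> t - t *\<^sub>R v)) + (h - s) *\<^sub>R v)"
          by (simp only: norm_minus_cancel)
        also have "\<dots> \<le> norm ((\<phi> t' - t' *\<^sub>R v) - (\<phi> t - t *\<^sub>R v)) + norm ((h - s) *\<^sub>R v)"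
          by (rule norm_triangle_ineq)
        also have "norm ((\<phi> t' - t' *\<^sub>R v) - (\<phi> t - t *\<^sub>R v)) \<le> \<eta>/8 * \<bar>h\<bar>"
          using lipschitz_on_normD[OF \<phi>, of t' t] by (simp add: h_def)
        finally show ?thesis by simp
      qed
      moreover have "norm (f (\<phi> t) + s *\<^sub>R y - f (\<phi> t')) \<le> \<eta>/8 * \<bar>h\<bar> + \<bar>h - s\<bar> * norm y"
      proof -
        have "f (\<phi> t) + s *\<^sub>R y - f (\<phi> t') = - ((G t' - G t - (t' - t) *\<^sub>R y) + (h - s) *\<^sub>R y)"
          using GT[OF tT] GT[OF t'(1)] by (simp add: h_def algebra_simps)
        then have "norm (f (\<phi> t) + s *\<^sub>R y - f (\<phi> t')) = norm ((G t' - G t - (t' - t) *\<^sub>R y) + (h - s) *\<^sub>R y)"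
          by (simp only: norm_minus_cancel)
        also have "\<dots> \<le> norm (G t' - G t - (t' - t) *\<^sub>R y) + norm ((h - s) *\<^sub>R y)"
          by (rule norm_triangle_ineq)
        also have "norm (G t' - G t - (t' - t) *\<^sub>R y) \<le> \<eta>/8 * \<bar>h\<bar>"
          using der[of t'] h s by (simp add: h_def)
        finally show ?thesis by simp
      qed
      ultimately have "dist (\<phi> t + s *\<^sub>R v, f (\<phi> t) + s *\<^sub>R y) (\<phi> t', f (\<phi> t'))
          \<le> \<eta>/4 * \<bar>h\<bar> + \<bar>h - s\<bar> * (norm v + norm y)"
        using dist_Pair_le[of "\<phi> t + s *\<^sub>R v" "f (\<phi> t) + s *\<^sub>R y" "\<phi> t'" "f (\<phi> t')"]
        by (simp add: algebra_simps)
      also have "\<dots> \<le> \<eta>/4 * (2 * \<bar>s\<bar>) + \<delta> * \<bar>s\<bar> * (norm v + norm y)"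
        using h hs \<eta> by (intro add_mono mult_mono) auto
      also have "\<dots> = \<eta>/2 * \<bar>s\<bar> + (\<delta> * (norm v + norm y)) * \<bar>s\<bar>" by (simp add: algebra_simps)
      also have "\<dots> \<le> \<eta>/2 * \<bar>s\<bar> + \<eta>/2 * \<bar>s\<bar>"
        using \<delta>K by (intro add_mono mult_right_mono) auto
      also have "\<dots> = \<eta> * \<bar>s\<bar>" by simp
      finally show "infdist (\<phi> t + s *\<^sub>R v, f (\<phi> t) + s *\<^sub>R y) ((\<lambda>z. (z, f z)) ` C) \<le> \<eta> * \<bar>s\<bar>"
        using t'(1) by (intro infdist_le2[of "(\<phi> t', f (\<phi> t'))"]) (auto simp: T_def)
    qed
    then show "False" using no d1 d2 by (metis half_gt_zero min_less_iff_conj)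
  qed
qed

section \<open>Sets negligible along a sequence of directions\<close>

text \<open>
  The sigma-ideal generated by the sets in \<open>Atilde_dir (v n)\<close>. The countably many Borel pieces are listed in a single sequence,
  piece \<open>k\<close> belonging to direction \<open>v (i k)\<close>; sorting the pieces by direction is
  postponed to \<open>Atilde_of_negligible_along\<close>.
\<close>

definition negligible_along :: "(nat \<Rightarrow> 'a::real_normed_vector) \<Rightarrow> 'a set \<Rightarrow> bool" where
  "negligible_along v N \<longleftrightarrow> (\<exists>B i \<epsilon>. (\<forall>k::nat. \<epsilon> k > 0 \<and> B k \<in> Atilde_eps (v (i k)) (\<epsilon> k)) \<and> N \<subseteq> (\<Union>k. B k))"

lemma empty_Atilde_eps: "{} \<in> Atilde_eps v \<epsilon>"
  by (simp add: Atilde_eps_def)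

lemma negligible_alongI: "B \<in> Atilde_eps (v i) \<epsilon> \<Longrightarrow> \<epsilon> > 0 \<Longrightarrow> N \<subseteq> B \<Longrightarrow> negligible_along v N"
  unfolding negligible_along_def by (intro exI[of _ "\<lambda>_. B"] exI[of _ "\<lambda>_. i"] exI[of _ "\<lambda>_. \<epsilon>"]) auto

lemma negligible_along_empty [simp]: "negligible_along v {}"
  by (rule negligible_alongI[OF empty_Atilde_eps zero_less_one]) simp

lemma negligible_along_subset: "negligible_along v N \<Longrightarrow> N' \<subseteq> N \<Longrightarrow> negligible_along v N'"
  unfolding negligible_along_def by (meson subset_trans)

lemma negligible_along_UN_nat:
  assumes "\<And>n::nat. negligible_along v (N n)"
  shows "negligible_along v (\<Union>n. N n)"
proof -
  from assms have "\<forall>n. \<exists>B i \<epsilon>. (\<forall>k::nat. \<epsilon> k > 0 \<and> B k \<in> Atilde_eps (v (i k)) (\<epsilon> k)) \<and> N n \<subseteq> (\<Union>k. B k)"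
    unfolding negligible_along_def by blast
  then have "\<exists>B i \<epsilon>. \<forall>n. (\<forall>k::nat. \<epsilon> n k > 0 \<and> B n k \<in> Atilde_eps (v (i n k)) (\<epsilon> n k)) \<and> N n \<subseteq> (\<Union>k. B n k)"
    by (simp only: choice_iff)
  then obtain B i \<epsilon> where *: "\<And>n k :: nat. \<epsilon> n k > 0 \<and> B n k \<in> Atilde_eps (v (i n k)) (\<epsilon> n k)"
    and sub: "\<And>n. N n \<subseteq> (\<Union>k. B n k)"
    by blast
  define p where "p = (prod_decode :: nat \<Rightarrow> nat \<times> nat)"
  have "(\<Union>n. N n) \<subseteq> (\<Union>k. B (fst (p k)) (snd (p k)))"
  proof
    fix x assume "x \<in> (\<Union>n. N n)"
    then obtain n k where "x \<in> B n k" using sub by blast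
    then have "x \<in> B (fst (p (prod_encode (n, k)))) (snd (p (prod_encode (n, k))))"
      by (simp add: p_def)
    then show "x \<in> (\<Union>k. B (fst (p k)) (snd (p k)))" by blast
  qed
  then show ?thesis
    unfolding negligible_along_def using *
    by (intro exI[of _ "\<lambda>k. B (fst (p k)) (snd (p k))"] exI[of _ "\<lambda>k. i (fst (p k)) (snd (p k))"]
        exI[of _ "\<lambda>k. \<epsilon> (fst (p k)) (snd (p k))"]) auto
qed

lemma negligible_along_UN:
  assumes "countable I" "\<And>i. i \<in> I \<Longrightarrow> negligible_along v (N i)"
  shows "negligible_along v (\<Union>i\<in>I. N i)"
proof (cases "I = {}")
  case False
  have "negligible_along v (\<Union>n. N (from_nat_into I n))"
    by (intro negligible_along_UN_nat assms(2) from_nat_into False)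
  moreover have "(\<Union>n. N (from_nat_into I n)) = (\<Union>i\<in>I. N i)"
    using range_from_nat_into[OF False assms(1)] by (metis image_image)
  ultimately show ?thesis by simp
qed simp

lemma negligible_along_Un:
  "negligible_along v N \<Longrightarrow> negligible_along v N' \<Longrightarrow> negligible_along v (N \<union> N')"
  using negligible_along_UN[of "UNIV :: bool set" v "\<lambda>b. if b then N else N'"]
  by (simp add: UNIV_bool Un_commute)

lemma borel_subset_Atilde_eps:
  assumes B: "B \<in> Atilde_eps v \<epsilon>" and E: "E \<in> sets borel"
  shows "E \<inter> B \<in> Atilde_eps v \<epsilon>"
  unfolding Atilde_eps_def
proof (intro CollectI conjI allI impI)
  show "E \<inter> B \<in> sets borel" using B E by (auto simp: Atilde_eps_def)
  fix \<phi> :: "real \<Rightarrow> 'a" assume "\<epsilon>-lipschitz_on UNIV (\<lambda>t. \<phi> t - t *\<^sub>R v)"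
  then have "negligible {t. \<phi> t \<in> B}" using B by (simp add: Atilde_eps_def negligible_iff_null_sets)
  then have "negligible {t. \<phi> t \<in> E \<inter> B}" by (rule negligible_subset) auto
  then show "{t. \<phi> t \<in> E \<inter> B} \<in> null_sets lebesgue" by (simp add: negligible_iff_null_sets)
qed

text \<open>
  A Borel set covered by admissible pieces is the union of its intersections with them, and these are
  again admissible. The pieces belonging to other directions than \<open>v n\<close> are replaced by the empty set.
\<close>

lemma Atilde_of_negligible_along:
  assumes E: "E \<in> sets borel" and null: "\<And>v. complete_sequence v \<Longrightarrow> negligible_along v E"
  shows "E \<in> Atilde"
  unfolding Atilde_def
proof (intro CollectI allI impI)
  fix v :: "nat \<Rightarrow> 'a" assume "complete_sequence v"
  from null[OF this] obtain B i \<epsilon> where *: "\<And>k::nat. \<epsilon> k > 0 \<and> B k \<in> Atilde_eps (v (i k)) (\<epsilon> k)"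
    and sub: "E \<subseteq> (\<Union>k. B k)"
    unfolding negligible_along_def by blast
  define Bn where "Bn n = (\<Union>k. if i k = n then E \<inter> B k else {})" for n
  show "\<exists>Bn. (\<forall>n. Bn n \<in> Atilde_dir (v n)) \<and> E = (\<Union>n. Bn n)"
  proof (intro exI[of _ Bn] conjI allI)
    fix n
    have "(if i k = n then E \<inter> B k else {}) \<in> Atilde_eps (v n) (\<epsilon> k)" for k
      using * borel_subset_Atilde_eps[OF _ E] empty_Atilde_eps by auto
    then show "Bn n \<in> Atilde_dir (v n)"
      unfolding Atilde_dir_def Bn_def using *
      by (intro CollectI exI[of _ "\<lambda>k. if i k = n then E \<inter> B k else {}"] exI[of _ \<epsilon>]) auto
  next
    have in_Bn: "x \<in> Bn (i k)" if "x \<in> E" "x \<in> B k" for x k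
      unfolding Bn_def using that by (intro UN_I[of k]) auto
    have "Bn n \<subseteq> E" for n by (auto simp: Bn_def split: if_splits)
    moreover have "E \<subseteq> (\<Union>n. Bn n)"
    proof
      fix x assume x: "x \<in> E"
      then obtain k where "x \<in> B k" using sub by (auto dest!: subsetD)
      then show "x \<in> (\<Union>n. Bn n)" using in_Bn[OF x] by (intro UN_I[of "i k"]) auto
    qed
    ultimately show "E = (\<Union>n. Bn n)" by (simp add: UN_least subset_antisym)
  qed
qed

text \<open>
  The target space may be non-separable. Only multiples of differences of values on \<open>A\<close> matter as
  slopes, and these form a continuous image of the separable space \<open>UNIV \<times> A \<times> A\<close>.
\<close>

lemma difference_quotients_separable:
  fixes f :: "'a::{real_normed_vector, second_countable_topology} \<Rightarrow> 'b::real_normed_vector"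
  assumes A: "closed A" and f: "continuous_on A f"
  obtains Q where "countable Q"
    "\<And>z x c e. z \<in> A \<Longrightarrow> x \<in> A \<Longrightarrow> e > 0 \<Longrightarrow> \<exists>q\<in>Q. norm (c *\<^sub>R (f z - f x) - q) < e"
proof -
  define S where "S = (UNIV :: real set) \<times> A \<times> A"
  define h where "h p = fst p *\<^sub>R (f (fst (snd p)) - f (snd (snd p)))" for p
  obtain T where T: "countable T" "T \<subseteq> S" "S \<subseteq> closure T" using separable[of S] by blast
  have S: "closed S" unfolding S_def by (intro closed_Times A closed_UNIV)
  have cont: "continuous_on S h"
    unfolding h_def S_def
    by (intro continuous_intros continuous_on_compose2[OF f]) auto
  have TS: "closure T = S" using T S by (simp add: closure_minimal subset_antisym)
  have "h ` closure T \<subseteq> closure (h ` T)"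
  proof (rule image_closure_subset)
    show "continuous_on (closure T) h" using cont by (simp add: TS)
  qed (simp_all add: closure_subset)
  then have hS: "h ` S \<subseteq> closure (h ` T)" by (simp add: TS)
  show thesis
  proof (rule that[of "h ` T"])
    show "countable (h ` T)" using T by simp
    fix z x c and e :: real assume zx: "z \<in> A" "x \<in> A" and e: "e > 0"
    then have "h (c, z, x) \<in> closure (h ` T)"
      using hS by (auto simp: S_def)
    then obtain q where "q \<in> h ` T" "dist q (h (c, z, x)) < e"
      using e unfolding closure_approachable by blast
    moreover from this have "norm (c *\<^sub>R (f z - f x) - q) < e"
      by (simp add: h_def dist_norm norm_minus_commute)
    ultimately show "\<exists>q\<in>h ` T. norm (c *\<^sub>R (f z - f x) - q) < e" by blast
  qed
qed

section \<open>Tangent directions at almost all points of a piece\<close>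

locale lipschitz_piece =
  fixes f :: "'a::{banach, second_countable_topology} \<Rightarrow> 'b::banach" and A :: "'a set" and L :: real
  assumes closed_A: "closed A" and lipschitz_f: "L-lipschitz_on A f"
begin

lemma continuous_f: "continuous_on A f"
  using lipschitz_f by (rule lipschitz_on_continuous_on)

lemma L_nonneg: "L \<ge> 0"
  using lipschitz_f by (rule lipschitz_on_nonneg)

definition slopes :: "'b set" where
  "slopes = (SOME Q. countable Q \<and>
     (\<forall>z\<in>A. \<forall>x\<in>A. \<forall>c. \<forall>e>0. \<exists>q\<in>Q. norm (c *\<^sub>R (f z - f x) - q) < e))"

text \<open>
  A countable supply of slopes, needed to write the relevant sets as countable unions of closed sets.
\<close>

lemma slopes: "countable slopes"
  "z \<in> A \<Longrightarrow> x \<in> A \<Longrightarrow> e > 0 \<Longrightarrow> \<exists>q\<in>slopes. norm (c *\<^sub>R (f z - f x) - q) < e"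
proof -
  have "\<exists>Q. countable Q \<and>
     (\<forall>z\<in>A. \<forall>x\<in>A. \<forall>c. \<forall>e>0. \<exists>q\<in>Q. norm (c *\<^sub>R (f z - f x) - q) < e)"
    using difference_quotients_separable[OF closed_A continuous_f] by metis
  from someI_ex[OF this] show "countable slopes"
    "z \<in> A \<Longrightarrow> x \<in> A \<Longrightarrow> e > 0 \<Longrightarrow> \<exists>q\<in>slopes. norm (c *\<^sub>R (f z - f x) - q) < e"
    unfolding slopes_def by blast+
qed

text \<open>
  A nearby point of the graph turns \<open>y\<close> into a difference quotient up to the error \<open>2 * \<eta>\<close>.
\<close>

lemma nearly_tangent_slope:
  assumes nt: "nearly_tangent f C u y \<eta> r x" and x: "x \<in> C" "C \<subseteq> A" and \<eta>: "\<eta> > 0" and r: "r > 0"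
  obtains q where "q \<in> slopes" "norm (y - q) \<le> 3 * \<eta>"
proof -
  define s where "s = r / 2"
  have s: "s > 0" "\<bar>s\<bar> < r" using r by (auto simp: s_def)
  obtain z where z: "z \<in> C" "norm (f z - (f x + s *\<^sub>R y)) \<le> 2 * \<eta> * \<bar>s\<bar>"
    using nearly_tangent_witness[OF nt x(1) \<eta>, of s] s by auto
  obtain q where q: "q \<in> slopes" "norm ((1 / s) *\<^sub>R (f z - f x) - q) < \<eta>"
    using slopes(2)[of z x \<eta> "1 / s"] z x \<eta> by auto
  have "(1 / s) *\<^sub>R (f z - f x) - y = (1 / s) *\<^sub>R (f z - (f x + s *\<^sub>R y))"
    using s by (simp add: algebra_simps)
  then have "norm ((1 / s) *\<^sub>R (f z - f x) - y) = norm (f z - (f x + s *\<^sub>R y)) / s"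
    using s by simp
  also have "\<dots> \<le> 2 * \<eta>" using z(2) s by (simp add: field_simps)
  finally have "norm ((1 / s) *\<^sub>R (f z - f x) - y) \<le> 2 * \<eta>" .
  then have "norm (y - q) \<le> 3 * \<eta>"
    using q(2) norm_triangle_ineq4[of "(1 / s) *\<^sub>R (f z - f x) - q" "(1 / s) *\<^sub>R (f z - f x) - y"]
    by simp
  then show thesis using that q(1) by blast
qed

lemma borel_nearly_tangent:
  assumes "C' \<subseteq> A" "C' \<in> sets borel"
  shows "{x \<in> C'. nearly_tangent f C u y \<eta> r x} \<in> sets borel"
proof -
  have "{x \<in> C'. nearly_tangent f C u y \<eta> r x} = C' \<inter> {x \<in> A. nearly_tangent f C u y \<eta> r x}"
    using assms(1) by auto
  then show ?thesis
    using borel_closed[OF closed_nearly_tangent[OF closed_A continuous_f]] assms(2) by simp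
qed

lemma ex_inverse_Suc_less: "r > 0 \<Longrightarrow> \<exists>m. 1 / real (Suc m) < r"
  using nat_approx_posE by blast

text \<open>
  The statement is required for all Borel subsets \<open>C\<close> of \<open>A\<close>, with points of the graph over the
  same \<open>C\<close>: this is what allows steps in different directions to be composed.
\<close>

definition ae_nearly_tangent :: "(nat \<Rightarrow> 'a) \<Rightarrow> 'a \<Rightarrow> bool" where
  "ae_nearly_tangent v u \<longleftrightarrow> (\<forall>C \<eta>. C \<subseteq> A \<longrightarrow> C \<in> sets borel \<longrightarrow> \<eta> > 0 \<longrightarrow>
     negligible_along v {x \<in> C. \<not> (\<exists>y r. r > 0 \<and> nearly_tangent f C u y \<eta> r x)})"

lemma ae_nearly_tangentD:
  "ae_nearly_tangent v u \<Longrightarrow> C \<subseteq> A \<Longrightarrow> C \<in> sets borel \<Longrightarrow> \<eta> > 0 \<Longrightarrow>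
     negligible_along v {x \<in> C. \<not> (\<exists>y r. r > 0 \<and> nearly_tangent f C u y \<eta> r x)}"
  by (simp add: ae_nearly_tangent_def)

text \<open>
  Restricting to slopes in \<open>slopes\<close> and to scales \<open>1 / Suc m\<close> makes the exceptional set
  Borel, and \<open>nearly_tangent_along_curve\<close>, applied with \<open>\<eta> / 4\<close> to leave room for changing the slope,
  says that it is null on every test curve.
\<close>

lemma ae_nearly_tangent_base:
  assumes rnp: "radon_nikodym_property TYPE('b)"
  shows "ae_nearly_tangent v (v i)"
  unfolding ae_nearly_tangent_def
proof (intro allI impI)
  fix C and \<eta> :: real assume C: "C \<subseteq> A" "C \<in> sets borel" and \<eta>: "\<eta> > 0"
  define B where "B = C - (\<Union>q\<in>slopes. \<Union>m. {x \<in> C. nearly_tangent f C (v i) q \<eta> (1 / real (Suc m)) x})"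
  have Bb: "B \<in> sets borel"
    unfolding B_def using C slopes(1)
    by (intro sets.Diff sets.countable_UN'' borel_nearly_tangent) auto
  have "B \<in> Atilde_eps (v i) (\<eta> / 32)"
    unfolding Atilde_eps_def
  proof (intro CollectI conjI allI impI Bb)
    fix \<phi> :: "real \<Rightarrow> 'a" assume "(\<eta> / 32)-lipschitz_on UNIV (\<lambda>t. \<phi> t - t *\<^sub>R v i)"
    then have \<phi>: "(\<eta> / 4 / 8)-lipschitz_on UNIV (\<lambda>t. \<phi> t - t *\<^sub>R v i)" by simp
    have \<eta>4: "\<eta> / 4 > 0" using \<eta> by simp
    have "negligible {t. \<phi> t \<in> B}"
    proof (rule negligible_subset[OF nearly_tangent_along_curve[OF rnp closed_A lipschitz_f C \<eta>4 \<phi>]],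
        intro subsetI CollectI conjI notI)
      fix t assume "t \<in> {t. \<phi> t \<in> B}"
      then have t: "\<phi> t \<in> B" by simp
      then show tC: "\<phi> t \<in> C" by (simp add: B_def)
      assume "\<exists>y r. 0 < r \<and> nearly_tangent f C (v i) y (\<eta> / 4) r (\<phi> t)"
      then obtain y r where r: "0 < r" and nt: "nearly_tangent f C (v i) y (\<eta> / 4) r (\<phi> t)" by blast
      obtain q where q: "q \<in> slopes" "norm (y - q) \<le> 3 * (\<eta> / 4)"
        using nearly_tangent_slope[OF nt tC C(1) \<eta>4 r] by blast
      obtain m where m: "1 / real (Suc m) < r" using ex_inverse_Suc_less[OF r] by blast
      have "nearly_tangent f C (v i) q (\<eta> / 4 + 3 * (\<eta> / 4)) r (\<phi> t)"
        using q by (intro nearly_tangent_perturb[OF nt]) (simp add: norm_minus_commute)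
      then have "nearly_tangent f C (v i) q \<eta> (1 / real (Suc m)) (\<phi> t)"
        by (rule nearly_tangent_mono) (use m in auto)
      then show False using t tC q(1) by (auto simp: B_def)
    qed
    then show "{t. \<phi> t \<in> B} \<in> null_sets lebesgue" by (simp add: negligible_iff_null_sets)
  qed
  then show "negligible_along v {x \<in> C. \<not> (\<exists>y r. r > 0 \<and> nearly_tangent f C (v i) y \<eta> r x)}"
  proof (rule negligible_alongI)
    show "{x \<in> C. \<not> (\<exists>y r. r > 0 \<and> nearly_tangent f C (v i) y \<eta> r x)} \<subseteq> B"
    proof
      fix x assume "x \<in> {x \<in> C. \<not> (\<exists>y r. r > 0 \<and> nearly_tangent f C (v i) y \<eta> r x)}"
      then have x: "x \<in> C" and no: "\<not> nearly_tangent f C (v i) y \<eta> r x" if "r > 0" for y r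
        using that by blast+
      show "x \<in> B"
        unfolding B_def using x[of 1] no[of "1 / real (Suc _)"] by auto
    qed
  qed (use \<eta> in simp)
qed

text \<open>
  On \<open>C1 q m\<close> the graph over \<open>C\<close> is nearly tangent to
  \<open>(u, q)\<close> up to the uniform scale \<open>1 / Suc m\<close>; the hypothesis on \<open>w\<close> is applied to the set \<open>C1 q m\<close>
  itself, so that \<open>nearly_tangent_add\<close> can be used. All three tangencies hold at the same points and with the same
  slopes, and this is where the derivative gets its additivity.
\<close>

lemma ae_nearly_tangent_pair:
  assumes u: "ae_nearly_tangent v u" and w: "ae_nearly_tangent v w"
    and C: "C \<subseteq> A" "C \<in> sets borel" and \<eta>: "\<eta> > 0"
  shows "negligible_along v {x \<in> C. \<not> (\<exists>y y' r. r > 0 \<and> nearly_tangent f C u y \<eta> r x \<and>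
      nearly_tangent f C w y' \<eta> r x \<and> nearly_tangent f C (u + w) (y + y') \<eta> r x)}"
proof -
  define C1 where "C1 q m = {x \<in> C. nearly_tangent f C u q (\<eta> / 2) (1 / real (Suc m)) x}" for q and m :: nat
  define N0 where "N0 = {x \<in> C. \<not> (\<exists>y r. r > 0 \<and> nearly_tangent f C u y (\<eta> / 8) r x)}"
  define N where "N q m = {x \<in> C1 q m. \<not> (\<exists>y r. r > 0 \<and> nearly_tangent f (C1 q m) w y (\<eta> / 2) r x)}" for q m
  have C1A: "C1 q m \<subseteq> C" "C1 q m \<subseteq> A" for q m using C by (auto simp: C1_def)
  have C1b: "C1 q m \<in> sets borel" for q m unfolding C1_def by (rule borel_nearly_tangent[OF C])
  have "negligible_along v N0"
    unfolding N0_def using \<eta> by (intro ae_nearly_tangentD[OF u C]) simp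
  moreover have "negligible_along v (\<Union>q\<in>slopes. \<Union>m. N q m)"
    unfolding N_def using \<eta>
    by (intro negligible_along_UN slopes ae_nearly_tangentD[OF w C1A(2) C1b]) auto
  ultimately have "negligible_along v (N0 \<union> (\<Union>q\<in>slopes. \<Union>m. N q m))" by (rule negligible_along_Un)
  then show ?thesis
  proof (rule negligible_along_subset, safe)
    fix x assume x: "x \<in> C" and notN: "x \<notin> (\<Union>q\<in>slopes. \<Union>m. N q m)"
      and no: "\<not> (\<exists>y y' r. r > 0 \<and> nearly_tangent f C u y \<eta> r x \<and>
      nearly_tangent f C w y' \<eta> r x \<and> nearly_tangent f C (u + w) (y + y') \<eta> r x)"
    show "x \<in> N0"
    proof (rule ccontr)
      assume "x \<notin> N0"
      then obtain y r where r: "r > 0" and nt: "nearly_tangent f C u y (\<eta> / 8) r x"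
        using x by (auto simp: N0_def)
      have \<eta>8: "\<eta> / 8 > 0" using \<eta> by simp
      obtain q where q: "q \<in> slopes" "norm (y - q) \<le> 3 * (\<eta> / 8)"
        using nearly_tangent_slope[OF nt x C(1) \<eta>8 r] by blast
      obtain m where m: "1 / real (Suc m) < r" using ex_inverse_Suc_less[OF r] by blast
      have "nearly_tangent f C u q (\<eta> / 8 + 3 * (\<eta> / 8)) r x"
        using q by (intro nearly_tangent_perturb[OF nt]) (simp add: norm_minus_commute)
      then have "nearly_tangent f C u q (\<eta> / 2) (1 / real (Suc m)) x"
        by (rule nearly_tangent_mono) (use m in auto)
      then have xC1: "x \<in> C1 q m" using x by (simp add: C1_def)
      moreover have "x \<notin> N q m" using notN q by auto
      ultimately obtain y' r' where r': "r' > 0" and nt': "nearly_tangent f (C1 q m) w y' (\<eta> / 2) r' x"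
        by (auto simp: N_def)
      define \<rho> where "\<rho> = min (1 / real (Suc m)) r'"
      have \<rho>: "\<rho> > 0" using r' by (simp add: \<rho>_def)
      have t1: "nearly_tangent f C u q (\<eta> / 2) \<rho> z" if "z \<in> C1 q m" for z
        using that by (auto simp: C1_def \<rho>_def intro: nearly_tangent_mono)
      have t2: "nearly_tangent f (C1 q m) w y' (\<eta> / 2) \<rho> x"
        using nt' by (rule nearly_tangent_mono) (auto simp: \<rho>_def)
      have "nearly_tangent f C (u + w) (q + y') (\<eta> / 2 + \<eta> / 2) \<rho> x"
        by (rule nearly_tangent_add[OF C1A(1) t1 xC1 t2])
      moreover have "nearly_tangent f C w y' (\<eta> / 2) \<rho> x"
        using nearly_tangent_superset[OF t2 C1A(1)] xC1 by auto
      ultimately have "nearly_tangent f C u q \<eta> \<rho> x" "nearly_tangent f C w y' \<eta> \<rho> x"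
        "nearly_tangent f C (u + w) (q + y') \<eta> \<rho> x"
        using t1[OF xC1] \<eta> by (auto intro: nearly_tangent_mono)
      then show False using no \<rho> by blast
    qed
  qed
qed

lemma ae_nearly_tangent_add:
  assumes "ae_nearly_tangent v u" "ae_nearly_tangent v w"
  shows "ae_nearly_tangent v (u + w)"
  unfolding ae_nearly_tangent_def
proof (intro allI impI)
  fix C and \<eta> :: real assume "C \<subseteq> A" "C \<in> sets borel" "\<eta> > 0"
  from ae_nearly_tangent_pair[OF assms this]
  show "negligible_along v {x \<in> C. \<not> (\<exists>y r. r > 0 \<and> nearly_tangent f C (u + w) y \<eta> r x)}"
    by (rule negligible_along_subset) blast
qed

lemma ae_nearly_tangent_zero: "ae_nearly_tangent v 0"
  unfolding ae_nearly_tangent_def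
proof (intro allI impI)
  fix C and \<eta> :: real assume "\<eta> > 0"
  then have "\<exists>y r. r > 0 \<and> nearly_tangent f C 0 y \<eta> r x" if "x \<in> C" for x
    using nearly_tangent_zero[OF that, of \<eta> f 1] by (intro exI[of _ 0] exI[of _ 1]) auto
  then have "{x \<in> C. \<not> (\<exists>y r. r > 0 \<and> nearly_tangent f C 0 y \<eta> r x)} = {}" by blast
  then show "negligible_along v {x \<in> C. \<not> (\<exists>y r. r > 0 \<and> nearly_tangent f C 0 y \<eta> r x)}"
    by (simp only: negligible_along_empty)
qed

lemma ae_nearly_tangent_scale:
  assumes u: "ae_nearly_tangent v u"
  shows "ae_nearly_tangent v (c *\<^sub>R u)"
proof (cases "c = 0")
  case True then show ?thesis by (simp add: ae_nearly_tangent_zero)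
next
  case False
  show ?thesis
    unfolding ae_nearly_tangent_def
  proof (intro allI impI)
    fix C and \<eta> :: real assume C: "C \<subseteq> A" "C \<in> sets borel" and \<eta>: "\<eta> > 0"
    have "negligible_along v {x \<in> C. \<not> (\<exists>y r. r > 0 \<and> nearly_tangent f C u y (\<eta> / \<bar>c\<bar>) r x)}"
      using \<eta> False by (intro ae_nearly_tangentD[OF u C]) simp
    then show "negligible_along v {x \<in> C. \<not> (\<exists>y r. r > 0 \<and> nearly_tangent f C (c *\<^sub>R u) y \<eta> r x)}"
    proof (rule negligible_along_subset, safe)
      fix x y r assume no: "\<not> (\<exists>y r. r > 0 \<and> nearly_tangent f C (c *\<^sub>R u) y \<eta> r x)"
        and r: "0 < r" and nt: "nearly_tangent f C u y (\<eta> / \<bar>c\<bar>) r x"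
      have "nearly_tangent f C (c *\<^sub>R u) (c *\<^sub>R y) \<eta> (r / \<bar>c\<bar>) x"
        using nearly_tangent_scale[OF nt False] False by simp
      then show False using no r False by (metis zero_less_abs_iff zero_less_divide_iff)
    qed
  qed
qed

lemma ae_nearly_tangent_span:
  assumes rnp: "radon_nikodym_property TYPE('b)" and u: "u \<in> span (range v)"
  shows "ae_nearly_tangent v u"
  using u
proof (induction rule: span_induct_alt)
  case base show ?case by (rule ae_nearly_tangent_zero)
next
  case (step c x y)
  then show ?case
    using ae_nearly_tangent_base[OF rnp, of v]
    by (auto intro!: ae_nearly_tangent_add ae_nearly_tangent_scale)
qed

lemma ae_nearly_tangent_complete:
  assumes rnp: "radon_nikodym_property TYPE('b)" and v: "complete_sequence v"
  shows "ae_nearly_tangent v u"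
  unfolding ae_nearly_tangent_def
proof (intro allI impI)
  fix C and \<eta> :: real assume C: "C \<subseteq> A" "C \<in> sets borel" and \<eta>: "\<eta> > 0"
  have \<eta>2: "\<eta> / 2 > 0" using \<eta> by simp
  have "u \<in> closure (span (range v))" using v by (simp add: complete_sequence_def)
  then obtain u' where u': "u' \<in> span (range v)" "dist u' u < \<eta> / 2"
    using \<eta>2 unfolding closure_approachable by blast
  have "negligible_along v {x \<in> C. \<not> (\<exists>y r. r > 0 \<and> nearly_tangent f C u' y (\<eta> / 2) r x)}"
    by (rule ae_nearly_tangentD[OF ae_nearly_tangent_span[OF rnp u'(1)] C \<eta>2])
  then show "negligible_along v {x \<in> C. \<not> (\<exists>y r. r > 0 \<and> nearly_tangent f C u y \<eta> r x)}"
  proof (rule negligible_along_subset, safe)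
    fix x y r assume no: "\<not> (\<exists>y r. r > 0 \<and> nearly_tangent f C u y \<eta> r x)"
      and r: "0 < r" and nt: "nearly_tangent f C u' y (\<eta> / 2) r x"
    have "nearly_tangent f C u y (\<eta> / 2 + \<eta> / 2) r x"
      using u'(2) by (intro nearly_tangent_perturb[OF nt]) (simp add: dist_norm norm_minus_commute)
    then show False using no r by auto
  qed
qed

definition additively_tangent :: "'a \<Rightarrow> 'a \<Rightarrow> real \<Rightarrow> 'a \<Rightarrow> bool" where
  "additively_tangent u w \<eta> x \<longleftrightarrow> (\<exists>y y' r. r > 0 \<and> nearly_tangent f A u y \<eta> r x \<and>
      nearly_tangent f A w y' \<eta> r x \<and> nearly_tangent f A (u + w) (y + y') \<eta> r x)"

text \<open>
  The exceptional set has to be fixed before the complete sequence \<open>v\<close> is given. It is therefore defined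
  through a fixed countable dense set of directions and countably many slopes; the previous lemmas show that
  it is negligible along each \<open>v\<close>, because \<open>ae_nearly_tangent v u\<close> holds for every \<open>u\<close>.
\<close>

lemma exceptional_set:
  assumes rnp: "radon_nikodym_property TYPE('b)"
  obtains E where "E \<in> sets borel" "\<And>v. complete_sequence v \<Longrightarrow> negligible_along v E"
    "\<And>x u w \<eta>. x \<in> A - E \<Longrightarrow> \<eta> > 0 \<Longrightarrow> additively_tangent u w \<eta> x"
proof -
  have Ab: "A \<in> sets borel" using closed_A by simp
  obtain W :: "'a set" where W: "countable W" "\<And>X. open X \<Longrightarrow> X \<noteq> {} \<Longrightarrow> \<exists>d\<in>W. d \<in> X"
    using countable_dense_setE by blast
  define P where "P u w n = (\<Union>q\<in>slopes. \<Union>q'\<in>slopes. \<Union>m.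
     {x \<in> A. nearly_tangent f A u q (1 / real (Suc n)) (1 / real (Suc m)) x} \<inter>
     {x \<in> A. nearly_tangent f A w q' (1 / real (Suc n)) (1 / real (Suc m)) x} \<inter>
     {x \<in> A. nearly_tangent f A (u + w) (q + q') (1 / real (Suc n)) (1 / real (Suc m)) x})" for u w and n :: nat
  define E where "E = (\<Union>u\<in>W. \<Union>w\<in>W. \<Union>n. A - P u w n)"
  have Pb: "P u w n \<in> sets borel" for u w n
    unfolding P_def
    by (intro sets.countable_UN'' sets.Int borel_nearly_tangent Ab slopes) auto
  show thesis
  proof
    show "E \<in> sets borel"
      unfolding E_def by (intro sets.countable_UN'' sets.Diff Ab Pb W) auto
    fix v :: "nat \<Rightarrow> 'a" assume v: "complete_sequence v"
    have "negligible_along v (A - P u w n)" for u w n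
    proof -
      \<comment> \<open>Moving the slopes into \<open>slopes\<close> costs \<open>3 * \<eta>\<close> for \<open>u\<close> and \<open>w\<close> and \<open>6 * \<eta>\<close> for \<open>u + w\<close>, so \<open>7 * \<eta>\<close> in all suffices.\<close>
      define \<eta> where "\<eta> = 1 / (8 * real (Suc n))"
      have \<eta>: "\<eta> > 0" by (simp add: \<eta>_def)
      have \<eta>n: "8 * \<eta> = 1 / real (Suc n)" by (simp add: \<eta>_def del: of_nat_Suc)
      from ae_nearly_tangent_pair[OF ae_nearly_tangent_complete[OF rnp v, of u]
          ae_nearly_tangent_complete[OF rnp v, of w] order_refl Ab \<eta>]
      show ?thesis
      proof (rule negligible_along_subset, safe)
        fix x y y' r assume x: "x \<in> A" and xP: "x \<notin> P u w n" and r: "r > 0"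
          and nt: "nearly_tangent f A u y \<eta> r x" "nearly_tangent f A w y' \<eta> r x"
            "nearly_tangent f A (u + w) (y + y') \<eta> r x"
        obtain q where q: "q \<in> slopes" "norm (y - q) \<le> 3 * \<eta>"
          using nearly_tangent_slope[OF nt(1) x order_refl \<eta> r] by blast
        obtain q' where q': "q' \<in> slopes" "norm (y' - q') \<le> 3 * \<eta>"
          using nearly_tangent_slope[OF nt(2) x order_refl \<eta> r] by blast
        obtain m where m: "1 / real (Suc m) < r" using ex_inverse_Suc_less[OF r] by blast
        have "norm ((q + q') - (y + y')) \<le> norm (q - y) + norm (q' - y')"
          using norm_triangle_ineq[of "q - y" "q' - y'"] by (simp add: algebra_simps)
        also have "\<dots> \<le> 6 * \<eta>" using q(2) q'(2) by (simp add: norm_minus_commute)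
        finally have qq: "norm ((q + q') - (y + y')) \<le> 6 * \<eta>" .
        have "nearly_tangent f A u q (\<eta> + 3 * \<eta>) r x"
          using q by (intro nearly_tangent_perturb[OF nt(1)]) (simp add: norm_minus_commute)
        moreover have "nearly_tangent f A w q' (\<eta> + 3 * \<eta>) r x"
          using q' by (intro nearly_tangent_perturb[OF nt(2)]) (simp add: norm_minus_commute)
        moreover have "nearly_tangent f A (u + w) (q + q') (\<eta> + 6 * \<eta>) r x"
          using qq by (intro nearly_tangent_perturb[OF nt(3)]) simp
        ultimately have "nearly_tangent f A u q (8 * \<eta>) (1 / real (Suc m)) x"
          "nearly_tangent f A w q' (8 * \<eta>) (1 / real (Suc m)) x"
          "nearly_tangent f A (u + w) (q + q') (8 * \<eta>) (1 / real (Suc m)) x"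
          using m \<eta> by (auto elim!: nearly_tangent_mono)
        then have "x \<in> P u w n"
          unfolding \<eta>n P_def using x q(1) q'(1) by blast
        then show False using xP by simp
      qed
    qed
    then show "negligible_along v E"
      unfolding E_def using W by (intro negligible_along_UN) auto
  next
    fix x u w and \<eta> :: real assume x: "x \<in> A - E" and \<eta>: "\<eta> > 0"
    obtain n where n: "1 / real (Suc n) < \<eta> / 2" using ex_inverse_Suc_less[of "\<eta> / 2"] \<eta> by auto
    obtain u' where u': "u' \<in> W" "u' \<in> ball u (\<eta> / 4)" using W(2)[of "ball u (\<eta> / 4)"] \<eta> by auto
    obtain w' where w': "w' \<in> W" "w' \<in> ball w (\<eta> / 4)" using W(2)[of "ball w (\<eta> / 4)"] \<eta> by auto
    have "x \<in> P u' w' n" using x u' w' by (auto simp: E_def)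
    then obtain q q' m where
      nt: "nearly_tangent f A u' q (1 / real (Suc n)) (1 / real (Suc m)) x"
        "nearly_tangent f A w' q' (1 / real (Suc n)) (1 / real (Suc m)) x"
        "nearly_tangent f A (u' + w') (q + q') (1 / real (Suc n)) (1 / real (Suc m)) x"
      unfolding P_def by blast
    have d: "norm (u - u') \<le> \<eta> / 4" "norm (w - w') \<le> \<eta> / 4"
      using u' w' by (auto simp: dist_norm)
    have "norm ((u + w) - (u' + w')) \<le> norm (u - u') + norm (w - w')"
      using norm_triangle_ineq[of "u - u'" "w - w'"] by (simp add: algebra_simps)
    then have d3: "norm ((u + w) - (u' + w')) \<le> \<eta> / 2" using d by simp
    have "nearly_tangent f A u q (1 / real (Suc n) + \<eta> / 2) (1 / real (Suc m)) x"
      using d \<eta> by (intro nearly_tangent_perturb[OF nt(1)]) simp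
    moreover have "nearly_tangent f A w q' (1 / real (Suc n) + \<eta> / 2) (1 / real (Suc m)) x"
      using d \<eta> by (intro nearly_tangent_perturb[OF nt(2)]) simp
    moreover have "nearly_tangent f A (u + w) (q + q') (1 / real (Suc n) + \<eta> / 2) (1 / real (Suc m)) x"
      using d3 \<eta> by (intro nearly_tangent_perturb[OF nt(3)]) simp
    ultimately have "nearly_tangent f A u q \<eta> (1 / real (Suc m)) x"
      "nearly_tangent f A w q' \<eta> (1 / real (Suc m)) x"
      "nearly_tangent f A (u + w) (q + q') \<eta> (1 / real (Suc m)) x"
      using n by (auto elim!: nearly_tangent_mono)
    then show "additively_tangent u w \<eta> x"
      unfolding additively_tangent_def
      by (intro exI[of _ q] exI[of _ q'] exI[of _ "1 / real (Suc m)"]) auto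
  qed
qed

text \<open>
  Compare the points of the graph reached from \<open>(x, f x)\<close> in the two directions, using that \<open>f\<close>
  is Lipschitz on \<open>A\<close>. With \<open>u = u'\<close> this is approximate uniqueness of the slope; with \<open>u' = 0\<close> it bounds
  the slope by \<open>L * norm u\<close>.
\<close>

lemma nearly_tangent_slopes_close:
  assumes nt: "nearly_tangent f A u y \<eta> r x" and nt': "nearly_tangent f A u' y' \<eta> r' x"
    and x: "x \<in> A" and pos: "\<eta> > 0" "r > 0" "r' > 0"
  shows "norm (y - y') \<le> L * norm (u - u') + 4 * (1 + L) * \<eta>"
proof -
  define s where "s = min r r' / 2"
  have s: "s > 0" "s < r" "s < r'" using pos by (auto simp: s_def)
  obtain z where z: "z \<in> A" "norm (z - (x + s *\<^sub>R u)) \<le> 2 * \<eta> * s"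
    "norm (f z - (f x + s *\<^sub>R y)) \<le> 2 * \<eta> * s"
    using nearly_tangent_witness[OF nt x pos(1), of s] s by auto
  obtain z' where z': "z' \<in> A" "norm (z' - (x + s *\<^sub>R u')) \<le> 2 * \<eta> * s"
    "norm (f z' - (f x + s *\<^sub>R y')) \<le> 2 * \<eta> * s"
    using nearly_tangent_witness[OF nt' x pos(1), of s] s by auto
  have tri: "norm (a - b + c) \<le> norm a + norm b + norm c" for a b c :: "'c::real_normed_vector"
    using norm_triangle_ineq[of "a - b" c] norm_triangle_ineq4[of a b] by linarith
  have "z - z' = (z - (x + s *\<^sub>R u)) - (z' - (x + s *\<^sub>R u')) + s *\<^sub>R (u - u')"
    by (simp add: algebra_simps)
  then have "norm (z - z') \<le> norm (z - (x + s *\<^sub>R u)) + norm (z' - (x + s *\<^sub>R u')) + norm (s *\<^sub>R (u - u'))"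
    by (simp only: tri)
  also have "norm (s *\<^sub>R (u - u')) = s * norm (u - u')" using s by simp
  finally have "norm (z - z') \<le> 4 * \<eta> * s + s * norm (u - u')"
    using z(2) z'(2) by linarith
  then have "L * norm (z - z') \<le> L * (4 * \<eta> * s + s * norm (u - u'))"
    using L_nonneg by (intro mult_left_mono) auto
  then have ff: "norm (f z - f z') \<le> L * (4 * \<eta> * s + s * norm (u - u'))"
    using lipschitz_on_normD[OF lipschitz_f z(1) z'(1)] by linarith
  have "s *\<^sub>R (y - y') = (f z' - (f x + s *\<^sub>R y')) - (f z - (f x + s *\<^sub>R y)) + (f z - f z')"
    by (simp add: algebra_simps)
  then have "norm (s *\<^sub>R (y - y')) \<le> norm (f z' - (f x + s *\<^sub>R y')) + norm (f z - (f x + s *\<^sub>R y)) + norm (f z - f z')"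
    by (simp only: tri)
  also have "norm (s *\<^sub>R (y - y')) = s * norm (y - y')" using s by simp
  finally have "s * norm (y - y') \<le> 4 * \<eta> * s + L * (4 * \<eta> * s + s * norm (u - u'))"
    using z(3) z'(3) ff by linarith
  also have "\<dots> = s * (L * norm (u - u') + 4 * (1 + L) * \<eta>)" by (simp add: algebra_simps)
  finally show ?thesis using s by simp
qed

text \<open>
  Slopes for smaller and smaller \<open>\<eta>\<close> form a Cauchy sequence by \<open>nearly_tangent_slopes_close\<close>.
\<close>

lemma tangent_slope_exists:
  assumes x: "x \<in> A" and ex: "\<And>\<eta>. \<eta> > 0 \<Longrightarrow> \<exists>y r. r > 0 \<and> nearly_tangent f A u y \<eta> r x"
  shows "\<exists>y. \<forall>\<eta>>0. \<exists>r>0. nearly_tangent f A u y \<eta> r x"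
proof -
  define \<epsilon> where "\<epsilon> n = 1 / real (Suc n)" for n
  have \<epsilon>: "\<epsilon> n > 0" for n by (simp add: \<epsilon>_def)
  have \<epsilon>0: "\<epsilon> \<longlonglongrightarrow> 0" unfolding \<epsilon>_def using LIMSEQ_inverse_real_of_nat by (simp add: inverse_eq_divide)
  have "\<forall>n. \<exists>y r. r > 0 \<and> nearly_tangent f A u y (\<epsilon> n) r x" using ex \<epsilon> by blast
  then obtain y r where r: "\<And>n. r n > 0" and nt: "\<And>n. nearly_tangent f A u (y n) (\<epsilon> n) (r n) x"
    by metis
  define K where "K = 4 * (1 + L)"
  have K: "K > 0" using L_nonneg by (simp add: K_def)
  have close: "norm (y n - y m) \<le> K * \<epsilon> n" if "n \<le> m" for n m
  proof -
    have "\<epsilon> m \<le> \<epsilon> n" using that by (simp add: \<epsilon>_def frac_le)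
    then have "nearly_tangent f A u (y m) (\<epsilon> n) (r m) x" using nearly_tangent_mono[OF nt[of m]] by blast
    from nearly_tangent_slopes_close[OF nt[of n] this x \<epsilon> r r] show ?thesis by (simp add: K_def)
  qed
  have "Cauchy y"
  proof (rule CauchyI')
    fix e :: real assume e: "e > 0"
    have "(\<lambda>n. K * \<epsilon> n) \<longlonglongrightarrow> K * 0" by (intro tendsto_intros \<epsilon>0)
    then have "eventually (\<lambda>n. K * \<epsilon> n < e) sequentially"
      using e by (intro order_tendstoD(2)[of _ 0]) auto
    then obtain M where M: "\<And>n. n \<ge> M \<Longrightarrow> K * \<epsilon> n < e" by (auto simp: eventually_sequentially)
    show "\<exists>M. \<forall>m\<ge>M. \<forall>n>m. dist (y m) (y n) < e"
    proof (intro exI[of _ M] allI impI)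
      fix m n assume "m \<ge> M" "n > m"
      then show "dist (y m) (y n) < e" using close[of m n] M[of m] by (simp add: dist_norm)
    qed
  qed
  then obtain d where d: "y \<longlonglongrightarrow> d" using Cauchy_convergent convergentD by blast
  have yd: "norm (d - y n) \<le> K * \<epsilon> n" for n
  proof (rule LIMSEQ_le_const2)
    show "(\<lambda>m. norm (y m - y n)) \<longlonglongrightarrow> norm (d - y n)" by (intro tendsto_intros d)
    show "\<exists>N. \<forall>m\<ge>N. norm (y m - y n) \<le> K * \<epsilon> n"
      using close[of n] by (metis norm_minus_commute)
  qed
  show ?thesis
  proof (intro exI[of _ d] allI impI)
    fix \<eta> :: real assume \<eta>: "\<eta> > 0"
    have "\<eta> / (1 + K) > 0" using \<eta> K by simp
    then obtain n where "\<epsilon> n < \<eta> / (1 + K)" using ex_inverse_Suc_less unfolding \<epsilon>_def by blast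
    then have n: "\<epsilon> n + K * \<epsilon> n \<le> \<eta>" using K by (simp add: field_simps)
    have "nearly_tangent f A u d (\<epsilon> n + K * \<epsilon> n) (r n) x"
      using yd by (intro nearly_tangent_perturb[OF nt]) simp
    then have "nearly_tangent f A u d \<eta> (r n) x" by (rule nearly_tangent_mono) (use n in auto)
    then show "\<exists>r>0. nearly_tangent f A u d \<eta> r x" using r by blast
  qed
qed

text \<open>
  Approximate slopes for \<open>u\<close>, \<open>w\<close> and \<open>u + w\<close> that add up exactly exist for every \<open>\<eta>\<close>, and each is within
  \<open>4 * (1 + L) * \<eta>\<close> of the limiting slope; so the limiting slopes are additive.
\<close>

lemma tangent_map_exists:
  assumes x: "x \<in> A" and good: "\<And>u w \<eta>. \<eta> > 0 \<Longrightarrow> additively_tangent u w \<eta> x"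
  obtains D where "bounded_linear D" "\<And>u \<eta>. \<eta> > 0 \<Longrightarrow> \<exists>r>0. nearly_tangent f A u (D u) \<eta> r x"
proof -
  have "\<exists>y. \<forall>\<eta>>0. \<exists>r>0. nearly_tangent f A u y \<eta> r x" for u
    using good[of _ u u, unfolded additively_tangent_def] by (intro tangent_slope_exists x) blast
  then obtain D where D: "\<And>u \<eta>. \<eta> > 0 \<Longrightarrow> \<exists>r>0. nearly_tangent f A u (D u) \<eta> r x" by metis
  define K where "K = 4 * (1 + L)"
  have K: "K > 0" using L_nonneg by (simp add: K_def)
  have uniq: "norm (D u - y) \<le> K * \<eta>" if "nearly_tangent f A u y \<eta> r x" "\<eta> > 0" "r > 0" for u y \<eta> r
  proof -
    obtain r' where r': "r' > 0" "nearly_tangent f A u (D u) \<eta> r' x" using D \<open>\<eta> > 0\<close> by blast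
    from nearly_tangent_slopes_close[OF r'(2) that(1) x that(2) r'(1) that(3)]
    show ?thesis by (simp add: K_def)
  qed
  have zero: "z = 0" if "\<And>\<eta>::real. \<eta> > 0 \<Longrightarrow> norm z \<le> c * \<eta>" "c > 0" for z :: 'b and c
  proof (rule ccontr)
    assume "z \<noteq> 0"
    then have "norm z / (2 * c) > 0" using that(2) by simp
    from that(1)[OF this] show False using that(2) \<open>z \<noteq> 0\<close> by simp
  qed
  have add: "D (u + w) = D u + D w" for u w
  proof -
    have "D (u + w) - (D u + D w) = 0"
    proof (rule zero)
      fix \<eta> :: real assume \<eta>: "\<eta> > 0"
      obtain y y' r where r: "r > 0" and nt: "nearly_tangent f A u y \<eta> r x" "nearly_tangent f A w y' \<eta> r x"
        "nearly_tangent f A (u + w) (y + y') \<eta> r x"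
        using good[OF \<eta>, of u w] by (auto simp: additively_tangent_def)
      have "D (u + w) - (D u + D w) = (D (u + w) - (y + y')) - (D u - y) - (D w - y')" by simp
      then have "norm (D (u + w) - (D u + D w))
          \<le> norm (D (u + w) - (y + y') - (D u - y)) + norm (D w - y')"
        by (simp only: norm_triangle_ineq4)
      also have "\<dots> \<le> norm (D (u + w) - (y + y')) + norm (D u - y) + norm (D w - y')"
        by (intro add_right_mono norm_triangle_ineq4)
      also have "\<dots> \<le> K * \<eta> + K * \<eta> + K * \<eta>" by (intro add_mono uniq[OF nt(1) \<eta> r] uniq[OF nt(2) \<eta> r] uniq[OF nt(3) \<eta> r])
      finally show "norm (D (u + w) - (D u + D w)) \<le> (3 * K) * \<eta>" by simp
    qed (use K in simp)
    then show ?thesis by simp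
  qed
  have D0: "D 0 = 0"
  proof (rule zero)
    fix \<eta> :: real assume \<eta>: "\<eta> > 0"
    show "norm (D 0) \<le> K * \<eta>" using uniq[OF nearly_tangent_zero[OF x], of \<eta> 1] \<eta> by simp
  qed (fact K)
  have scale: "D (c *\<^sub>R u) = c *\<^sub>R D u" for c u
  proof (cases "c = 0")
    case True then show ?thesis by (simp add: D0)
  next
    case False
    have "D (c *\<^sub>R u) - c *\<^sub>R D u = 0"
    proof (rule zero)
      fix \<eta> :: real assume \<eta>: "\<eta> > 0"
      obtain r where r: "r > 0" "nearly_tangent f A u (D u) \<eta> r x" using D \<eta> by blast
      from uniq[OF nearly_tangent_scale[OF r(2) False]] r(1) \<eta> False
      show "norm (D (c *\<^sub>R u) - c *\<^sub>R D u) \<le> (K * \<bar>c\<bar>) * \<eta>" by (simp add: mult_ac)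
    qed (use K False in simp)
    then show ?thesis by simp
  qed
  have bound: "norm (D u) \<le> norm u * L" for u
  proof -
    have "norm (D u) \<le> norm u * L + e" if e: "e > 0" for e
    proof -
      have \<eta>: "e / K > 0" using e K by simp
      obtain r where r: "r > 0" "nearly_tangent f A u (D u) (e / K) r x" using D \<eta> by blast
      have z: "nearly_tangent f A 0 0 (e / K) r x" using \<eta> by (intro nearly_tangent_zero x) simp
      from nearly_tangent_slopes_close[OF r(2) z x \<eta> r(1) r(1)]
      have "norm (D u) \<le> L * norm u + K * (e / K)" by (simp add: K_def)
      then show ?thesis using K by (simp add: mult.commute)
    qed
    then show ?thesis by (rule field_le_epsilon)
  qed
  show thesis
    by (rule that[OF bounded_linear_intro[of D L] D]) (auto intro: add scale bound)
qed

end

section \<open>Gateaux differentiability and the decomposition into pieces\<close>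

text \<open>
  The point \<open>x + t u\<close> need not lie in \<open>A\<close>, but some \<open>z \<in> A\<close> lies within \<open>2 * \<eta> * \<bar>t\<bar>\<close> of it, and the Lipschitz
  estimate at \<open>z\<close> holds against arbitrary points.
\<close>

lemma gateaux_differentiable_of_tangent:
  fixes f :: "'a::real_normed_vector \<Rightarrow> 'b::real_normed_vector"
  assumes x: "x \<in> A" and \<rho>: "\<rho> > 0" and L: "L \<ge> 0"
    and lip: "\<And>z y. z \<in> A \<Longrightarrow> norm (y - z) < \<rho> \<Longrightarrow> norm (f y - f z) \<le> L * norm (y - z)"
    and D: "bounded_linear D" "\<And>u \<eta>. \<eta> > 0 \<Longrightarrow> \<exists>r>0. nearly_tangent f A u (D u) \<eta> r x"
  shows "gateaux_differentiable_at f x"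
  unfolding gateaux_differentiable_at_def
proof (intro exI[of _ D] conjI allI D(1))
  fix u
  show "has_directional_derivative f x u (D u)"
    unfolding has_directional_derivative_def
  proof (rule LIM_I)
    fix e :: real assume e: "e > 0"
    define \<eta> where "\<eta> = e / (4 * (1 + L))"
    have L1: "1 + L > 0" using L by simp
    then have \<eta>: "\<eta> > 0" using e by (simp add: \<eta>_def)
    have "2 * (1 + L) * \<eta> = e / 2" using L1 by (simp add: \<eta>_def field_simps)
    then have \<eta>e: "2 * (1 + L) * \<eta> < e" using e by simp
    obtain r where r: "r > 0" and nt: "nearly_tangent f A u (D u) \<eta> r x" using D(2)[OF \<eta>] by blast
    define d where "d = min r (\<rho> / (2 * \<eta>))"
    show "\<exists>d>0. \<forall>t. t \<noteq> 0 \<and> norm (t - 0) < d \<longrightarrow> norm ((f (x + t *\<^sub>R u) - f x) /\<^sub>R t - D u) < e"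
    proof (intro exI[of _ d] conjI allI impI)
      show "d > 0" using r \<rho> \<eta> by (simp add: d_def)
      fix t :: real assume "t \<noteq> 0 \<and> norm (t - 0) < d"
      then have t: "t \<noteq> 0" "\<bar>t\<bar> < r" "2 * \<eta> * \<bar>t\<bar> < \<rho>"
        using \<eta> by (auto simp: d_def field_simps)
      obtain z where z: "z \<in> A" "norm (z - (x + t *\<^sub>R u)) \<le> 2 * \<eta> * \<bar>t\<bar>"
        "norm (f z - (f x + t *\<^sub>R D u)) \<le> 2 * \<eta> * \<bar>t\<bar>"
        using nearly_tangent_witness[OF nt x \<eta> t(1,2)] by blast
      have "norm (f (x + t *\<^sub>R u) - f z) \<le> L * norm ((x + t *\<^sub>R u) - z)"
        using z(2) t(3) by (intro lip z) (simp add: norm_minus_commute)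
      also have "\<dots> \<le> L * (2 * \<eta> * \<bar>t\<bar>)"
        using z(2) L by (intro mult_left_mono) (auto simp: norm_minus_commute)
      finally have "norm ((f (x + t *\<^sub>R u) - f z) + (f z - (f x + t *\<^sub>R D u))) \<le> L * (2 * \<eta> * \<bar>t\<bar>) + 2 * \<eta> * \<bar>t\<bar>"
        using z(3) by (intro norm_triangle_le add_mono)
      then have "norm (f (x + t *\<^sub>R u) - f x - t *\<^sub>R D u) \<le> 2 * (1 + L) * \<eta> * \<bar>t\<bar>"
        by (simp add: algebra_simps)
      also have "\<dots> < e * \<bar>t\<bar>" using \<eta>e t(1) by (intro mult_strict_right_mono) auto
      finally have lt: "norm (f (x + t *\<^sub>R u) - f x - t *\<^sub>R D u) < e * \<bar>t\<bar>" .
      have "(f (x + t *\<^sub>R u) - f x) /\<^sub>R t - D u = (f (x + t *\<^sub>R u) - f x - t *\<^sub>R D u) /\<^sub>R t"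
        using t(1) by (simp add: scaleR_diff_right)
      then have "norm ((f (x + t *\<^sub>R u) - f x) /\<^sub>R t - D u)
          = norm (f (x + t *\<^sub>R u) - f x - t *\<^sub>R D u) / \<bar>t\<bar>"
        by (simp add: divide_inverse_commute)
      also have "\<dots> < e" using lt t(1) by (simp add: field_simps)
      finally show "norm ((f (x + t *\<^sub>R u) - f x) /\<^sub>R t - D u) < e" .
    qed
  qed
qed

definition uniform_lipschitz_points ::
    "('a::real_normed_vector \<Rightarrow> 'b::real_normed_vector) \<Rightarrow> real \<Rightarrow> real \<Rightarrow> 'a set" where
  "uniform_lipschitz_points f L \<rho> = {x. \<forall>y. norm (y - x) < \<rho> \<longrightarrow> norm (f y - f x) \<le> L * norm (y - x)}"

text \<open>
  If \<open>x n\<close> tends to \<open>l\<close>, the estimate at \<open>x n\<close>, taken against \<open>l\<close>,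
  first gives that \<open>f (x n)\<close> tends to \<open>f l\<close>; then the estimates at \<open>x n\<close> pass to the limit.
\<close>

lemma closed_uniform_lipschitz_points:
  assumes \<rho>: "\<rho> > 0"
  shows "closed (uniform_lipschitz_points f L \<rho>)"
  unfolding closed_sequential_limits
proof (intro allI impI, elim conjE)
  fix x l assume xs: "\<forall>n. x n \<in> uniform_lipschitz_points f L \<rho>" and l: "x \<longlonglongrightarrow> l"
  have lip: "norm (f y - f (x n)) \<le> L * norm (y - x n)" if "norm (y - x n) < \<rho>" for y n
    using xs that by (auto simp: uniform_lipschitz_points_def)
  have near: "eventually (\<lambda>n. norm (y - x n) < \<rho>) sequentially" if "norm (y - l) < \<rho>" for y
    using l that by (intro order_tendstoD(2)[of _ "norm (y - l)"] tendsto_intros)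
  have "(\<lambda>n. L * norm (l - x n)) \<longlonglongrightarrow> L * norm (l - l)" by (intro tendsto_intros l)
  then have "(\<lambda>n. L * norm (l - x n)) \<longlonglongrightarrow> 0" by simp
  moreover have "eventually (\<lambda>n. norm (f (x n) - f l) \<le> L * norm (l - x n)) sequentially"
    using near[of l] \<rho> lip by (auto elim!: eventually_mono simp: norm_minus_commute[of "f (x _)"])
  ultimately have "(\<lambda>n. f (x n) - f l) \<longlonglongrightarrow> 0" by (metis Lim_null_comparison)
  then have fl: "(\<lambda>n. f (x n)) \<longlonglongrightarrow> f l" by (simp add: LIM_zero_iff)
  show "l \<in> uniform_lipschitz_points f L \<rho>"
    unfolding uniform_lipschitz_points_def
  proof (intro CollectI allI impI)
    fix y assume y: "norm (y - l) < \<rho>"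
    show "norm (f y - f l) \<le> L * norm (y - l)"
    proof (rule tendsto_le[OF trivial_limit_sequentially])
      show "(\<lambda>n. L * norm (y - x n)) \<longlonglongrightarrow> L * norm (y - l)" by (intro tendsto_intros l)
      show "(\<lambda>n. norm (f y - f (x n))) \<longlonglongrightarrow> norm (f y - f l)" by (intro tendsto_intros fl)
      show "eventually (\<lambda>n. norm (f y - f (x n)) \<le> L * norm (y - x n)) sequentially"
        using near[OF y] lip by (auto elim: eventually_mono)
    qed
  qed
qed

lemma lipschitz_points_subset:
  "lipschitz_points f \<subseteq> (\<Union>n. uniform_lipschitz_points f (real n) (1 / real (Suc n)))"
proof
  fix x assume "x \<in> lipschitz_points f"
  then have "Limsup (at x) (\<lambda>y. ereal (norm (f x - f y) / norm (x - y))) < \<infinity>"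
    by (simp add: lipschitz_points_def pointwise_lipschitz_at_def)
  then obtain c where "Limsup (at x) (\<lambda>y. ereal (norm (f x - f y) / norm (x - y))) < ereal c"
    using ereal_dense2 by blast
  then have "eventually (\<lambda>y. ereal (norm (f x - f y) / norm (x - y)) < ereal c) (at x)"
    by (rule Limsup_lessD)
  then obtain d where d: "d > 0"
    and dd: "\<And>y. y \<noteq> x \<Longrightarrow> dist y x < d \<Longrightarrow> norm (f x - f y) / norm (x - y) < c"
    by (auto simp: eventually_at)
  obtain m where m: "1 / real (Suc m) < d" using nat_approx_posE[OF d] by blast
  obtain k where k: "c \<le> real k" using real_arch_simple by blast
  define n where "n = max m k"
  have n: "1 / real (Suc n) < d" "c \<le> real n"
  proof -
    have "1 / real (Suc n) \<le> 1 / real (Suc m)" by (intro frac_le) (auto simp: n_def)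
    then show "1 / real (Suc n) < d" using m by linarith
    show "c \<le> real n" using k by (simp add: n_def)
  qed
  have "x \<in> uniform_lipschitz_points f (real n) (1 / real (Suc n))"
    unfolding uniform_lipschitz_points_def
  proof (intro CollectI allI impI)
    fix y assume y: "norm (y - x) < 1 / real (Suc n)"
    show "norm (f y - f x) \<le> real n * norm (y - x)"
    proof (cases "y = x")
      case False
      have "norm (f x - f y) / norm (x - y) < c" using dd[of y] False y n by (simp add: dist_norm)
      then have "norm (f x - f y) < c * norm (x - y)" using False by (simp add: field_simps)
      also have "\<dots> \<le> real n * norm (x - y)" using n by (intro mult_right_mono) auto
      finally show ?thesis by (simp add: norm_minus_commute)
    qed simp
  qed
  then show "x \<in> (\<Union>n. uniform_lipschitz_points f (real n) (1 / real (Suc n)))" by blast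
qed

text \<open>
  Intersecting the sets of uniform Lipschitz points with small balls turns the local estimate into a genuine Lipschitz
  condition; radius \<open>\<rho> n / 3\<close> keeps two points of a piece at distance less than \<open>\<rho> n\<close>.
\<close>

theorem theorem10:
  fixes f :: "'a::{banach, second_countable_topology} \<Rightarrow> 'b::banach"
  assumes "radon_nikodym_property TYPE('b)"
  shows "\<exists>E\<in>(Atilde :: 'a set set). \<forall>x \<in> lipschitz_points f - E. gateaux_differentiable_at f x"
proof -
  obtain W :: "'a set" where W: "countable W" "\<And>X. open X \<Longrightarrow> X \<noteq> {} \<Longrightarrow> \<exists>d\<in>W. d \<in> X"
    using countable_dense_setE by blast
  define \<rho> where "\<rho> n = 1 / real (Suc n)" for n
  have \<rho>: "\<rho> n > 0" for n by (simp add: \<rho>_def)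
  define A where "A n w = uniform_lipschitz_points f (real n) (\<rho> n) \<inter> cball w (\<rho> n / 3)" for n w
  have lip: "norm (f y - f z) \<le> real n * norm (y - z)" if "z \<in> A n w" "norm (y - z) < \<rho> n" for n w y z
    using that by (auto simp: A_def uniform_lipschitz_points_def)
  have piece: "lipschitz_piece f (A n w) (real n)" for n w
  proof
    show "closed (A n w)"
      unfolding A_def by (intro closed_Int closed_uniform_lipschitz_points \<rho> closed_cball)
    show "(real n)-lipschitz_on (A n w) f"
    proof (rule lipschitz_onI)
      fix y z assume yz: "y \<in> A n w" "z \<in> A n w"
      have "dist y z \<le> dist w y + dist w z" by (rule dist_triangle3)
      also have "\<dots> < \<rho> n" using yz \<rho>[of n] by (auto simp: A_def)
      finally show "dist (f y) (f z) \<le> real n * dist y z"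
        using lip[OF yz(2), of y] by (simp add: dist_norm)
    qed simp
  qed
  have "\<exists>E. E \<in> sets borel \<and> (\<forall>v. complete_sequence v \<longrightarrow> negligible_along v E) \<and>
      (\<forall>x\<in>A n w - E. gateaux_differentiable_at f x)" for n w
  proof -
    interpret lipschitz_piece f "A n w" "real n" by (rule piece)
    obtain E where E: "E \<in> sets borel" "\<And>v. complete_sequence v \<Longrightarrow> negligible_along v E"
      and good: "\<And>x u w' \<eta>. x \<in> A n w - E \<Longrightarrow> \<eta> > 0 \<Longrightarrow> additively_tangent u w' \<eta> x"
      using exceptional_set[OF assms] by blast
    have "gateaux_differentiable_at f x" if x: "x \<in> A n w - E" for x
    proof -
      obtain D where D: "bounded_linear D" "\<And>u \<eta>. \<eta> > 0 \<Longrightarrow> \<exists>r>0. nearly_tangent f (A n w) u (D u) \<eta> r x"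
        using tangent_map_exists[of x] good[OF x] x by auto
      show ?thesis
        by (rule gateaux_differentiable_of_tangent[OF _ \<rho>[of n] L_nonneg lip D]) (use x in auto)
    qed
    then show ?thesis using E by blast
  qed
  then obtain E where E: "\<And>n w. E n w \<in> sets borel"
    "\<And>n w v. complete_sequence v \<Longrightarrow> negligible_along v (E n w)"
    "\<And>n w x. x \<in> A n w - E n w \<Longrightarrow> gateaux_differentiable_at f x"
    by metis
  show ?thesis
  proof (intro bexI[of _ "\<Union>n. \<Union>w\<in>W. E n w"] ballI)
    show "(\<Union>n. \<Union>w\<in>W. E n w) \<in> Atilde"
    proof (rule Atilde_of_negligible_along)
      show "(\<Union>n. \<Union>w\<in>W. E n w) \<in> sets borel"
        by (intro sets.countable_UN'' E W) auto
      show "negligible_along v (\<Union>n. \<Union>w\<in>W. E n w)" if "complete_sequence v" for v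
        by (intro negligible_along_UN E W that) auto
    qed
    fix x assume x: "x \<in> lipschitz_points f - (\<Union>n. \<Union>w\<in>W. E n w)"
    then have "x \<in> (\<Union>n. uniform_lipschitz_points f (real n) (\<rho> n))"
      unfolding \<rho>_def by (intro subsetD[OF lipschitz_points_subset]) simp
    then obtain n where n: "x \<in> uniform_lipschitz_points f (real n) (\<rho> n)" by (rule UN_E)
    obtain w where w: "w \<in> W" "w \<in> ball x (\<rho> n / 3)" using W(2)[of "ball x (\<rho> n / 3)"] \<rho>[of n] by auto
    then have "x \<in> A n w" using n by (simp add: A_def dist_commute)
    then show "gateaux_differentiable_at f x" using E(3)[of x n w] x w(1) by auto
  qed
qed

end
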